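(* Let $\Omega$ be a non-empty compact metrizable space and $\tau$ an action of $\mathbb{Z}^l$ or of $(\mathbb{N}\cup\{0\})^l$ on $\Omega$ by continuous maps, for some $l\in\mathbb{N}$, such that the measure-theoretic entropy $h^\tau$ is finite and upper semi-continuous on $\mathcal{M}^\tau(\Omega)$. Let $f\in C(\Omega)$. Assume that there exists a vector subspace $V\subset C(\Omega)$, dense in $C(\Omega)$ for the uniform topology, such that $f+g$ has a unique equilibrium state for every $g\in V$. Then for each $\mu\in\mathcal{M}^\tau(\Omega)$ there exists a sequence $(\mu_n,g_n)_{n\in\mathbb{N}}$ in $\mathcal{M}^\tau(\Omega)\times V$ such that $\mu_n\to\mu$ in the weak-$*$ topology, $h^\tau(\mu_n)\to h^\tau(\mu)$, and for every $n$, $\mu_n$ is the (unique) equilibrium state for $f+g_n$.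
   Context: $C(\Omega)$ is the space of real-valued continuous functions on $\Omega$ with the uniform topology; $\mathcal{M}(\Omega)$ is the set of Borel probability measures on $\Omega$ with the weak-$*$ topology; $\mathcal{M}^\tau(\Omega)$ is the (compact) subset of $\tau$-invariant elements; $h^\tau(\mu)$ is the measure-theoretic entropy of $\mu\in\mathcal{M}^\tau(\Omega)$ for the action $\tau$. The pressure is $P^\tau(g)=\sup_{\mu\in\mathcal{M}^\tau(\Omega)}\{\mu(g)+h^\tau(\mu)\}$ for $g\in C(\Omega)$ (variational principle), where $\mu(g)=\int g\,d\mu$; an equilibrium state for $g$ is a $\mu\in\mathcal{M}^\tau(\Omega)$ attaining this supremum (which is a maximum under the standing assumptions). *)

theory Defs
  imports "HOL-Probability.Probability"
begin

text \<open>An action of the monoid (N u {0})^l on Omega by continuous maps is the same as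
  l pairwise commuting continuous self-maps T 0, ..., T (l-1) of Omega.  An action of Z^l is
  the special case where these maps are homeomorphisms; invariant measures and the entropy
  (computed along the Folner boxes [0,n)^l) are the same for the Z^l action and for its
  restriction to (N u {0})^l.\<close>

definition cont_action :: "'a::topological_space set \<Rightarrow> nat \<Rightarrow> (nat \<Rightarrow> 'a \<Rightarrow> 'a) \<Rightarrow> bool" where
  "cont_action \<Omega> l T \<longleftrightarrow>
     (\<forall>i<l. continuous_on \<Omega> (T i) \<and> T i ` \<Omega> \<subseteq> \<Omega>) \<and>
     (\<forall>i<l. \<forall>j<l. \<forall>x\<in>\<Omega>. T i (T j x) = T j (T i x))"

definition act :: "nat \<Rightarrow> (nat \<Rightarrow> 'a \<Rightarrow> 'a) \<Rightarrow> (nat \<Rightarrow> nat) \<Rightarrow> 'a \<Rightarrow> 'a" where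
  "act l T v = foldr (\<lambda>i g. (T i ^^ v i) \<circ> g) [0..<l] id"

definition vecs :: "nat \<Rightarrow> (nat \<Rightarrow> nat) set" where
  "vecs l = {..<l} \<rightarrow>\<^sub>E (UNIV :: nat set)"

definition box_l :: "nat \<Rightarrow> nat \<Rightarrow> (nat \<Rightarrow> nat) set" where
  "box_l l n = {..<l} \<rightarrow>\<^sub>E {..<n}"

definition prob_measures :: "'a::topological_space set \<Rightarrow> 'a measure set" where
  "prob_measures \<Omega> = {\<mu>. sets \<mu> = sets (restrict_space borel \<Omega>) \<and> prob_space \<mu>}"

definition inv_measures :: "'a::topological_space set \<Rightarrow> nat \<Rightarrow> (nat \<Rightarrow> 'a \<Rightarrow> 'a) \<Rightarrow> 'a measure set" where
  "inv_measures \<Omega> l T = {\<mu> \<in> prob_measures \<Omega>.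
     \<forall>v\<in>vecs l. \<forall>A\<in>sets \<mu>. measure \<mu> (act l T v -` A \<inter> \<Omega>) = measure \<mu> A}"

definition weak_star_conv :: "'a::topological_space set \<Rightarrow> (nat \<Rightarrow> 'a measure) \<Rightarrow> 'a measure \<Rightarrow> bool" where
  "weak_star_conv \<Omega> \<mu>s \<mu> \<longleftrightarrow>
     (\<forall>g::'a \<Rightarrow> real. continuous_on \<Omega> g \<longrightarrow>
        (\<lambda>n. \<integral>x. g x \<partial>(\<mu>s n)) \<longlonglongrightarrow> (\<integral>x. g x \<partial>\<mu>))"

definition eta :: "real \<Rightarrow> real" where
  "eta t = (if t = 0 then 0 else - t * ln t)"

definition meas_partitions :: "'a::topological_space set \<Rightarrow> 'a set set set" where
  "meas_partitions \<Omega> = {P. finite P \<and> P \<subseteq> sets (restrict_space borel \<Omega>) \<and> disjoint P \<and> \<Union>P = \<Omega>}"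

definition part_entropy :: "'a measure \<Rightarrow> 'a set set \<Rightarrow> real" where
  "part_entropy \<mu> P = (\<Sum>A\<in>P. eta (measure \<mu> A))"

definition join_box :: "'a set \<Rightarrow> nat \<Rightarrow> (nat \<Rightarrow> 'a \<Rightarrow> 'a) \<Rightarrow> nat \<Rightarrow> 'a set set \<Rightarrow> 'a set set" where
  "join_box \<Omega> l T n P = {\<Omega> \<inter> (\<Inter>v\<in>box_l l n. act l T v -` a v) | a. a \<in> box_l l n \<rightarrow>\<^sub>E P}"

definition part_ent_rate :: "'a set \<Rightarrow> nat \<Rightarrow> (nat \<Rightarrow> 'a \<Rightarrow> 'a) \<Rightarrow> 'a measure \<Rightarrow> 'a set set \<Rightarrow> real" where
  "part_ent_rate \<Omega> l T \<mu> P = lim (\<lambda>n. part_entropy \<mu> (join_box \<Omega> l T n P) / real n ^ l)"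

definition KS_entropy :: "'a::topological_space set \<Rightarrow> nat \<Rightarrow> (nat \<Rightarrow> 'a \<Rightarrow> 'a) \<Rightarrow> 'a measure \<Rightarrow> ereal" where
  "KS_entropy \<Omega> l T \<mu> = (SUP P\<in>meas_partitions \<Omega>. ereal (part_ent_rate \<Omega> l T \<mu> P))"

definition entropy_usc :: "'a::topological_space set \<Rightarrow> nat \<Rightarrow> (nat \<Rightarrow> 'a \<Rightarrow> 'a) \<Rightarrow> bool" where
  "entropy_usc \<Omega> l T \<longleftrightarrow>
     (\<forall>\<mu>s \<mu>. (\<forall>n. \<mu>s n \<in> inv_measures \<Omega> l T) \<and> \<mu> \<in> inv_measures \<Omega> l T \<and> weak_star_conv \<Omega> \<mu>s \<mu>
        \<longrightarrow> limsup (\<lambda>n. KS_entropy \<Omega> l T (\<mu>s n)) \<le> KS_entropy \<Omega> l T \<mu>)"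

definition pressure :: "'a::topological_space set \<Rightarrow> nat \<Rightarrow> (nat \<Rightarrow> 'a \<Rightarrow> 'a) \<Rightarrow> ('a \<Rightarrow> real) \<Rightarrow> ereal" where
  "pressure \<Omega> l T g = (SUP \<mu>\<in>inv_measures \<Omega> l T. ereal (\<integral>x. g x \<partial>\<mu>) + KS_entropy \<Omega> l T \<mu>)"

definition equilibrium_state :: "'a::topological_space set \<Rightarrow> nat \<Rightarrow> (nat \<Rightarrow> 'a \<Rightarrow> 'a) \<Rightarrow> ('a \<Rightarrow> real) \<Rightarrow> 'a measure \<Rightarrow> bool" where
  "equilibrium_state \<Omega> l T g \<mu> \<longleftrightarrow>
     \<mu> \<in> inv_measures \<Omega> l T \<and> ereal (\<integral>x. g x \<partial>\<mu>) + KS_entropy \<Omega> l T \<mu> = pressure \<Omega> l T g"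

definition C_subspace :: "'a::topological_space set \<Rightarrow> ('a \<Rightarrow> real) set \<Rightarrow> bool" where
  "C_subspace \<Omega> V \<longleftrightarrow> V \<subseteq> {g. continuous_on \<Omega> g} \<and> (\<lambda>x. 0) \<in> V \<and>
     (\<forall>g\<in>V. \<forall>h\<in>V. (\<lambda>x. g x + h x) \<in> V) \<and> (\<forall>c::real. \<forall>g\<in>V. (\<lambda>x. c * g x) \<in> V)"

definition uniformly_dense :: "'a::topological_space set \<Rightarrow> ('a \<Rightarrow> real) set \<Rightarrow> bool" where
  "uniformly_dense \<Omega> V \<longleftrightarrow>
     (\<forall>\<phi>. continuous_on \<Omega> \<phi> \<longrightarrow> (\<forall>\<epsilon>>0. \<exists>g\<in>V. \<forall>x\<in>\<Omega>. \<bar>\<phi> x - g x\<bar> < \<epsilon>))"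

end

theory Submission
  imports Defs
begin

text \<open>
  Fix finitely many \<open>w\<^sub>0, \<dots>, w\<^sub>k\<^sub>-\<^sub>1\<close> in \<open>V\<close> and \<open>\<delta> > 0\<close>, and minimise
  \<open>P(f + \<Sum> c\<^sub>i w\<^sub>i) - \<Sum> c\<^sub>i \<mu>(w\<^sub>i) + \<delta>/2 \<Sum> c\<^sub>i\<^sup>2\<close> over \<open>c\<close>; the pressure term minus the linear term is
  bounded below by \<open>\<mu>(f) + h(\<mu>)\<close>, so a minimiser exists and \<open>\<delta> \<Sum> c\<^sub>i\<^sup>2\<close> is bounded independently
  of \<open>\<delta>\<close>. Uniqueness of equilibrium states, compactness and upper semicontinuity make the pressure
  differentiable along \<open>V\<close>, and the first-order condition reads \<open>\<nu>(w\<^sub>i) = \<mu>(w\<^sub>i) - \<delta> c\<^sub>i\<close> for the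
  equilibrium state \<open>\<nu>\<close> at the minimiser. Hence \<open>\<nu>(w\<^sub>i)\<close> is close to \<open>\<mu>(w\<^sub>i)\<close> for small \<open>\<delta>\<close>, and
  comparing \<open>\<mu>\<close> with \<open>\<nu>\<close> in the variational principle gives \<open>h(\<nu>) \<ge> h(\<mu>) + \<mu>(f) - \<nu>(f)\<close>. Letting
  the \<open>w\<^sub>i\<close> run through a countable family in \<open>V\<close> that determines weak-* convergence yields the
  sequence; upper semicontinuity bounds its entropies from above. Affinity of the entropy
  plays no role.

  Weak-* sequential compactness is transferred from Helly's theorem on the real line: \<open>\<Omega>\<close> has a Borel
  injection into a compact set of reals whose inverse is uniformly continuous, hence extends
  continuously to the closure of the image.
\<close>

section \<open>Probability measures on a compact metric space\<close>

lemma prob_measuresD: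
  assumes "\<mu> \<in> prob_measures \<Omega>"
  shows "prob_space \<mu>" "sets \<mu> = sets (restrict_space borel \<Omega>)" "space \<mu> = \<Omega>"
proof -
  show "prob_space \<mu>" and s: "sets \<mu> = sets (restrict_space borel \<Omega>)"
    using assms by (auto simp: prob_measures_def)
  show "space \<mu> = \<Omega>"
    using sets_eq_imp_space_eq[OF s] by (simp add: space_restrict_space)
qed

lemma measurable_prob_measures_eq:
  assumes "\<mu> \<in> prob_measures \<Omega>"
  shows "measurable \<mu> N = measurable (restrict_space borel \<Omega>) N"
  using prob_measuresD(2)[OF assms] by (rule measurable_cong_sets) simp

lemma integrable_continuous_on_prob_measures:
  fixes g :: "'a::topological_space \<Rightarrow> real"
  assumes "compact \<Omega>" "continuous_on \<Omega> g" "\<mu> \<in> prob_measures \<Omega>"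
  shows "integrable \<mu> g"
proof -
  interpret prob_space \<mu> using prob_measuresD(1)[OF assms(3)] .
  have "bounded (g ` \<Omega>)"
    using compact_continuous_image[OF assms(2,1)] compact_imp_bounded by blast
  then obtain B where B: "\<And>x. x \<in> \<Omega> \<Longrightarrow> norm (g x) \<le> B"
    by (auto simp: bounded_iff)
  show ?thesis
  proof (rule integrable_const_bound[where B=B])
    show "AE x in \<mu>. norm (g x) \<le> B"
      using B prob_measuresD(3)[OF assms(3)] by (intro AE_I2) blast
    show "g \<in> borel_measurable \<mu>"
      using borel_measurable_continuous_on_restrict[OF assms(2)]
      by (simp add: measurable_prob_measures_eq[OF assms(3)])
  qed
qed

lemma integral_diff_le_prob_measures:
  fixes g h :: "'a::topological_space \<Rightarrow> real"
  assumes "compact \<Omega>" "continuous_on \<Omega> g" "continuous_on \<Omega> h" "\<mu> \<in> prob_measures \<Omega>"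
    and le: "\<And>x. x \<in> \<Omega> \<Longrightarrow> \<bar>g x - h x\<bar> \<le> e"
  shows "\<bar>(\<integral>x. g x \<partial>\<mu>) - (\<integral>x. h x \<partial>\<mu>)\<bar> \<le> e"
proof -
  interpret prob_space \<mu> using prob_measuresD(1)[OF assms(4)] .
  have i: "integrable \<mu> g" "integrable \<mu> h"
    using integrable_continuous_on_prob_measures assms by blast+
  have le': "AE x in \<mu>. g x - h x \<le> e" "AE x in \<mu>. - e \<le> g x - h x"
    using le prob_measuresD(3)[OF assms(4)] by (fastforce intro!: AE_I2)+
  have "(\<integral>x. g x - h x \<partial>\<mu>) \<le> e" "- e \<le> (\<integral>x. g x - h x \<partial>\<mu>)"
    using integral_le_const[OF _ le'(1)] integral_ge_const[OF _ le'(2)] i by auto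
  then show ?thesis using i by (simp add: abs_le_iff)
qed

text \<open>Relatively closed sets form an intersection-stable generator of the Borel sets of
  \<open>\<Omega>\<close>. The indicator of a closed \<open>C\<close> is the pointwise limit of the
  continuous functions \<open>max 0 (1 - n * infdist x C)\<close>, all bounded by 1, so dominated
  convergence recovers the measure of \<open>C\<close> from integrals of continuous
  functions.\<close>

lemma prob_measures_eqI:
  fixes \<Omega> :: "'a::metric_space set"
  assumes "compact \<Omega>" "\<mu> \<in> prob_measures \<Omega>" "\<nu> \<in> prob_measures \<Omega>"
    and eq: "\<And>g::'a \<Rightarrow> real. continuous_on \<Omega> g \<Longrightarrow> (\<integral>x. g x \<partial>\<mu>) = (\<integral>x. g x \<partial>\<nu>)"
  shows "\<mu> = \<nu>"
proof -
  interpret M: prob_space \<mu> using prob_measuresD(1)[OF assms(2)] .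
  interpret N: prob_space \<nu> using prob_measuresD(1)[OF assms(3)] .
  define E where "E = (\<lambda>C. \<Omega> \<inter> C) ` Collect closed"
  have sets_E: "sets (restrict_space borel \<Omega>) = sigma_sets \<Omega> E"
    unfolding E_def borel_eq_closed
    using sigma_sets_Int[of \<Omega> UNIV "Collect closed"] compact_imp_closed[OF assms(1)]
    by (simp add: sets_restrict_space sets_measure_of sigma_sets.Basic)
  have lim: "(\<lambda>n. \<integral>x. max 0 (1 - real n * infdist x C) \<partial>\<mu>') \<longlonglongrightarrow> measure \<mu>' (\<Omega> \<inter> C)"
    if "\<mu>' \<in> prob_measures \<Omega>" "closed C" "C \<noteq> {}" for \<mu>' and C :: "'a set"
  proof -
    interpret P: prob_space \<mu>' using prob_measuresD(1)[OF that(1)] .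
    have [measurable]: "\<Omega> \<inter> C \<in> sets \<mu>'"
      using that unfolding prob_measuresD(2)[OF that(1)] sets_restrict_space by auto
    have "(\<lambda>n. \<integral>x. max 0 (1 - real n * infdist x C) \<partial>\<mu>') \<longlonglongrightarrow> (\<integral>x. indicator (\<Omega> \<inter> C) x \<partial>\<mu>')"
    proof (rule integral_dominated_convergence[where w="\<lambda>_. 1"])
      show "AE x in \<mu>'. (\<lambda>n. max 0 (1 - real n * infdist x C)) \<longlonglongrightarrow> indicator (\<Omega> \<inter> C) x"
      proof (rule AE_I2)
        fix x assume "x \<in> space \<mu>'"
        then have x: "x \<in> \<Omega>" using prob_measuresD(3)[OF that(1)] by simp
        show "(\<lambda>n. max 0 (1 - real n * infdist x C)) \<longlonglongrightarrow> indicator (\<Omega> \<inter> C) x"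
        proof (cases "x \<in> C")
          case True
          then show ?thesis using x by simp
        next
          case False
          then have d: "infdist x C > 0"
            using that by (simp add: infdist_pos_not_in_closed)
          obtain N :: nat where N: "1 / infdist x C < real N" using reals_Archimedean2 by blast
          have "max 0 (1 - real n * infdist x C) = 0" if "n \<ge> N" for n
          proof -
            have "1 / infdist x C < real n" using N that by linarith
            then show ?thesis using d by (simp add: field_simps)
          qed
          then have "(\<lambda>n. max 0 (1 - real n * infdist x C)) \<longlonglongrightarrow> 0"
            by (intro tendsto_eventually) (auto simp: eventually_sequentially)
          then show ?thesis using False by simp
        qed
      qed
      show "(\<lambda>x. max 0 (1 - real n * infdist x C)) \<in> borel_measurable \<mu>'" for n
        unfolding measurable_prob_measures_eq[OF that(1)]
        by (intro borel_measurable_continuous_on_restrict continuous_intros)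
    qed (auto simp: infdist_nonneg)
    moreover have "(\<integral>x. indicator (\<Omega> \<inter> C) x \<partial>\<mu>') = measure \<mu>' (\<Omega> \<inter> C)"
      by simp
    ultimately show ?thesis by simp
  qed
  show ?thesis
  proof (rule measure_eqI_generator_eq[where E=E and \<Omega>=\<Omega> and A="\<lambda>_. \<Omega>"])
    show "Int_stable E"
    proof (rule Int_stableI)
      fix a b assume "a \<in> E" "b \<in> E"
      then obtain C D where "closed C" "closed D" "a = \<Omega> \<inter> C" "b = \<Omega> \<inter> D" by (auto simp: E_def)
      then have "a \<inter> b = \<Omega> \<inter> (C \<inter> D)" "closed (C \<inter> D)" by auto
      then show "a \<inter> b \<in> E" by (auto simp: E_def)
    qed
    show "emeasure \<mu> X = emeasure \<nu> X" if "X \<in> E" for X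
    proof -
      from that obtain C where C: "X = \<Omega> \<inter> C" "closed C" by (auto simp: E_def)
      \<comment> \<open>The empty set is split off because \<open>infdist x {}\<close> is 0 by
        convention: the approximating functions would be constantly 1 there.\<close>
      show ?thesis
      proof (cases "C = {}")
        case False
        have "(\<integral>x. max 0 (1 - real n * infdist x C) \<partial>\<mu>) = (\<integral>x. max 0 (1 - real n * infdist x C) \<partial>\<nu>)" for n
          by (intro eq continuous_intros)
        then have "measure \<mu> X = measure \<nu> X"
          using lim[OF assms(2) C(2) False] lim[OF assms(3) C(2) False] LIMSEQ_unique
          unfolding C(1) by auto
        then show ?thesis by (simp add: M.emeasure_eq_measure N.emeasure_eq_measure)
      qed (simp add: C)
    qed
    show "\<And>i. emeasure \<mu> \<Omega> \<noteq> \<infinity>" by simp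
    show "range (\<lambda>_. \<Omega>) \<subseteq> E" unfolding E_def by force
  qed (use sets_E prob_measuresD(2) assms in \<open>auto simp: E_def\<close>)
qed

section \<open>Borel coding of a compact metric space by real numbers\<close>

lemma compact_finite_nets:
  fixes \<Omega> :: "'a::metric_space set"
  assumes "compact \<Omega>"
  obtains X :: "nat \<Rightarrow> 'a set"
  where "\<And>n. finite (X n)" "\<And>n. X n \<subseteq> \<Omega>" "\<And>n. \<Omega> \<subseteq> (\<Union>x\<in>X n. ball x (1 / real (Suc n)))"
proof -
  have "\<exists>k. finite k \<and> k \<subseteq> \<Omega> \<and> \<Omega> \<subseteq> (\<Union>x\<in>k. ball x (1 / real (Suc n)))" for n
    using seq_compact_imp_totally_bounded[OF compact_imp_seq_compact[OF assms]] by simp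
  then show thesis using that by metis
qed

text \<open>The sequence enumerates all balls of all the finite nets. If the net of radius below
  \<open>e/2\<close> is exhausted before index \<open>N\<close>, two points with the same membership
  pattern up to \<open>N\<close> share a ball of that net.\<close>

lemma compact_separating_open_sequence:
  fixes \<Omega> :: "'a::metric_space set"
  assumes "compact \<Omega>"
  obtains A :: "nat \<Rightarrow> 'a set" where "\<And>n. open (A n)"
    "\<And>e. e > 0 \<Longrightarrow> \<exists>N. \<forall>x\<in>\<Omega>. \<forall>y\<in>\<Omega>. (\<forall>n<N. x \<in> A n \<longleftrightarrow> y \<in> A n) \<longrightarrow> dist x y < e"
proof -
  obtain X where X: "\<And>n. finite (X n)" "\<And>n. \<Omega> \<subseteq> (\<Union>x\<in>X n. ball x (1 / real (Suc n)))"
    using compact_finite_nets[OF assms] by metis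
  \<comment> \<open>\<open>UNIV\<close> keeps \<open>B\<close> nonempty even for empty
    \<open>\<Omega>\<close>, so every value of \<open>from_nat_into B\<close> is an open
    set.\<close>
  define B where "B = insert UNIV (\<Union>n. (\<lambda>x. ball x (1 / real (Suc n))) ` X n)"
  have cB: "countable B" unfolding B_def using X(1) by (intro countable_insert countable_UN) (auto intro: countable_finite)
  have ne: "B \<noteq> {}" by (auto simp: B_def)
  let ?A = "from_nat_into B"
  show thesis
  proof
    show "open (?A n)" for n
      using from_nat_into[OF ne, of n] by (auto simp: B_def)
    fix e :: real assume "e > 0"
    then obtain n where n: "1 / real (Suc n) < e / 2"
      using nat_approx_posE[of "e/2"] by (auto simp: field_simps)
    let ?F = "(\<lambda>x. ball x (1 / real (Suc n))) ` X n"
    define N where "N = Suc (Max (to_nat_on B ` ?F))"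
    have "dist x y < e" if xy: "x \<in> \<Omega>" "y \<in> \<Omega>" "\<forall>n<N. x \<in> ?A n \<longleftrightarrow> y \<in> ?A n" for x y
    proof -
      obtain z where z: "z \<in> X n" "x \<in> ball z (1 / real (Suc n))" using X(2) xy(1) by blast
      let ?b = "ball z (1 / real (Suc n))"
      have b: "?b \<in> B" using z by (auto simp: B_def)
      have "to_nat_on B ?b < N"
        unfolding N_def less_Suc_eq_le using X(1) z by (intro Max_ge) auto
      moreover have "?A (to_nat_on B ?b) = ?b" using cB b by simp
      ultimately have "y \<in> ?b" using xy(3) z(2) by metis
      then have "dist z x < e/2" "dist z y < e/2" using z n by auto
      then show ?thesis using dist_triangle_half_r by blast
    qed
    then show "\<exists>N. \<forall>x\<in>\<Omega>. \<forall>y\<in>\<Omega>. (\<forall>n<N. x \<in> ?A n \<longleftrightarrow> y \<in> ?A n) \<longrightarrow> dist x y < e" by blast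
  qed
qed

text \<open>At the first index \<open>m\<close> where the digits differ, the term has size
  \<open>(1/3)^m\<close>, while all later terms add up to at most half of that. Digits 0 and 1 in
  base 3 thus leave a gap; in base 2 the tail could cancel the leading difference.\<close>

lemma ternary_digits_close:
  fixes a b :: "nat \<Rightarrow> bool"
  assumes "\<bar>(\<Sum>k. of_bool (a k) * (1/3) ^ k) - (\<Sum>k. of_bool (b k) * (1/3) ^ k)\<bar> < (1/2) * (1/3::real) ^ N"
    and "n < N"
  shows "a n = b n"
proof (rule ccontr)
  assume "a n \<noteq> b n"
  define m where "m = (LEAST n. a n \<noteq> b n)"
  have m: "a m \<noteq> b m" "m \<le> n" and eq: "\<And>k. k < m \<Longrightarrow> a k = b k"
    unfolding m_def using LeastI[of "\<lambda>n. a n \<noteq> b n", OF \<open>a n \<noteq> b n\<close>]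
      Least_le[of "\<lambda>n. a n \<noteq> b n", OF \<open>a n \<noteq> b n\<close>] not_less_Least[of _ "\<lambda>n. a n \<noteq> b n"]
    by blast+
  have geo: "summable (\<lambda>k. (1/3::real) ^ k)" by (simp add: summable_geometric)
  have sum1: "summable (\<lambda>k. of_bool (c k) * (1/3::real) ^ k)" for c :: "nat \<Rightarrow> bool"
    by (rule summable_comparison_test'[OF geo]) auto
  let ?d = "\<lambda>k. (of_bool (a k) - of_bool (b k)) * (1/3::real) ^ k"
  have sd: "summable ?d" using summable_diff[OF sum1[of a] sum1[of b]] by (simp add: left_diff_distrib)
  have D: "(\<Sum>k. of_bool (a k) * (1/3) ^ k) - (\<Sum>k. of_bool (b k) * (1/3) ^ k) = (\<Sum>k. ?d k)"
    by (subst suminf_diff[OF sum1 sum1]) (simp add: left_diff_distrib)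
  have "(\<Sum>k. ?d k) = (\<Sum>k. ?d (k + Suc m)) + (\<Sum>k<Suc m. ?d k)"
    by (rule suminf_split_initial_segment[OF sd])
  moreover have "(\<Sum>k<Suc m. ?d k) = ?d m" using eq by simp
  moreover have "\<bar>?d m\<bar> = (1/3) ^ m" using m(1) by auto
  moreover have "\<bar>\<Sum>k. ?d (k + Suc m)\<bar> \<le> (1/2) * (1/3) ^ m"
  proof -
    have "(\<lambda>k. (1/3) ^ Suc m * (1/3::real) ^ k) sums ((1/3) ^ Suc m * (1 / (1 - 1/3)))"
      by (intro sums_mult geometric_sums) simp
    then have s: "(\<lambda>k. (1/3::real) ^ (k + Suc m)) sums ((1/2) * (1/3) ^ m)"
      by (simp add: power_add mult.commute)
    have "norm (\<Sum>k. ?d (k + Suc m)) \<le> (\<Sum>k. (1/3::real) ^ (k + Suc m))"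
      by (rule norm_suminf_le) (use sums_summable[OF s] in auto)
    then show ?thesis using sums_unique[OF s] by simp
  qed
  ultimately have "(1/2) * (1/3) ^ m \<le> \<bar>\<Sum>k. ?d k\<bar>" by linarith
  moreover have "(1/3::real) ^ N \<le> (1/3) ^ m" using m(2) assms(2) by (intro power_decreasing) auto
  ultimately show False using assms(1) unfolding D by linarith
qed

text \<open>The \<open>k\<close>-th ternary digit of \<open>s x\<close> records membership in the
  \<open>k\<close>-th open set. Such a code is Borel but need not be continuous; what matters is
  that close codes share their first \<open>N\<close> digits, so the inverse is uniformly
  continuous.\<close>

lemma compact_borel_code:
  fixes \<Omega> :: "'a::metric_space set"
  assumes "compact \<Omega>"
  obtains s :: "'a \<Rightarrow> real" where "s \<in> borel_measurable (restrict_space borel \<Omega>)"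
    "\<And>x. s x \<in> {0..2}"
    "\<And>e. e > 0 \<Longrightarrow> \<exists>d>0. \<forall>x\<in>\<Omega>. \<forall>y\<in>\<Omega>. \<bar>s x - s y\<bar> < d \<longrightarrow> dist x y < e"
proof -
  obtain A :: "nat \<Rightarrow> 'a set" where A: "\<And>n. open (A n)"
    "\<And>e. e > 0 \<Longrightarrow> \<exists>N. \<forall>x\<in>\<Omega>. \<forall>y\<in>\<Omega>. (\<forall>n<N. x \<in> A n \<longleftrightarrow> y \<in> A n) \<longrightarrow> dist x y < e"
    using compact_separating_open_sequence[OF assms] by metis
  define s where "s x = (\<Sum>k. of_bool (x \<in> A k) * (1/3::real) ^ k)" for x
  have geo: "(\<lambda>k. (1/3::real) ^ k) sums (3/2)"
    using geometric_sums[of "1/3::real"] by simp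
  have sm: "summable (\<lambda>k. of_bool (x \<in> A k) * (1/3::real) ^ k)" for x
    by (rule summable_comparison_test'[OF sums_summable[OF geo]]) auto
  show thesis
  proof
    have "(\<lambda>x. of_bool (x \<in> A k) :: real) \<in> borel_measurable (restrict_space borel \<Omega>)" for k
    proof -
      have "(indicator (A k) :: 'a \<Rightarrow> real) \<in> borel_measurable borel" using A(1) by auto
      then have "(indicator (A k) :: 'a \<Rightarrow> real) \<in> borel_measurable (restrict_space borel \<Omega>)"
        by (rule measurable_restrict_space1)
      moreover have "(indicator (A k) :: 'a \<Rightarrow> real) = (\<lambda>x. of_bool (x \<in> A k))"
        by (auto simp: indicator_def)
      ultimately show ?thesis by simp
    qed
    then show "s \<in> borel_measurable (restrict_space borel \<Omega>)"
      unfolding s_def by (intro borel_measurable_suminf borel_measurable_times) auto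
    show "s x \<in> {0..2}" for x
    proof -
      have "s x \<le> (\<Sum>k. (1/3) ^ k)"
        unfolding s_def by (intro suminf_le sm sums_summable[OF geo]) auto
      moreover have "0 \<le> s x" unfolding s_def by (intro suminf_nonneg sm) auto
      ultimately show ?thesis using sums_unique[OF geo] by simp
    qed
    fix e :: real assume "e > 0"
    then obtain N where N: "\<forall>x\<in>\<Omega>. \<forall>y\<in>\<Omega>. (\<forall>n<N. x \<in> A n \<longleftrightarrow> y \<in> A n) \<longrightarrow> dist x y < e"
      using A(2) by blast
    have "dist x y < e" if "x \<in> \<Omega>" "y \<in> \<Omega>" "\<bar>s x - s y\<bar> < (1/2) * (1/3) ^ N" for x y
      using N that(1,2) ternary_digits_close[of "\<lambda>k. x \<in> A k" "\<lambda>k. y \<in> A k" N] that(3)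
      unfolding s_def by blast
    then show "\<exists>d>0. \<forall>x\<in>\<Omega>. \<forall>y\<in>\<Omega>. \<bar>s x - s y\<bar> < d \<longrightarrow> dist x y < e"
      by (intro exI[of _ "(1/2) * (1/3) ^ N"]) auto
  qed
qed

text \<open>Extension of a uniformly continuous inverse to the closure of its domain. Compactness
  supplies the values: points whose codes tend to \<open>c\<close> have a convergent subsequence,
  and its limit serves as \<open>\<psi> c\<close>.\<close>

lemma continuous_decoding:
  fixes \<Omega> :: "'a::metric_space set" and s :: "'a \<Rightarrow> real"
  assumes "compact \<Omega>"
    and unif: "\<And>e. e > 0 \<Longrightarrow> \<exists>d>0. \<forall>x\<in>\<Omega>. \<forall>y\<in>\<Omega>. \<bar>s x - s y\<bar> < d \<longrightarrow> dist x y < e"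
  obtains \<psi> where "continuous_on (closure (s ` \<Omega>)) \<psi>" "\<psi> ` closure (s ` \<Omega>) \<subseteq> \<Omega>"
    "\<And>x. x \<in> \<Omega> \<Longrightarrow> \<psi> (s x) = x"
proof -
  let ?C = "closure (s ` \<Omega>)"
  \<comment> \<open>The stated property, that all points with code near \<open>c\<close> lie near
    \<open>x\<close>, is all that is used about \<open>\<psi> c\<close> afterwards.\<close>
  have "\<exists>x\<in>\<Omega>. \<forall>e>0. \<exists>d>0. \<forall>y\<in>\<Omega>. \<bar>s y - c\<bar> < d \<longrightarrow> dist y x < e" if "c \<in> ?C" for c
  proof -
    from that obtain z where z: "\<And>n. z n \<in> s ` \<Omega>" "z \<longlonglongrightarrow> c" unfolding closure_sequential by auto
    then have "\<forall>n. \<exists>x\<in>\<Omega>. z n = s x" by auto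
    then obtain u where u: "\<And>n. u n \<in> \<Omega>" "\<And>n. z n = s (u n)" by metis
    obtain x r where x: "x \<in> \<Omega>" "strict_mono r" "(u \<circ> r) \<longlonglongrightarrow> x"
      using compact_imp_seq_compact[OF assms(1)] u(1) unfolding seq_compact_def by metis
    have zr: "(\<lambda>n. s (u (r n))) \<longlonglongrightarrow> c"
      using LIMSEQ_subseq_LIMSEQ[OF z(2) x(2)] by (simp add: o_def u(2))
    show ?thesis
    proof (intro bexI[OF _ x(1)] allI impI)
      fix e :: real assume "e > 0"
      then obtain d where d: "d > 0" "\<forall>x\<in>\<Omega>. \<forall>y\<in>\<Omega>. \<bar>s x - s y\<bar> < d \<longrightarrow> dist x y < e/2"
        using unif[of "e/2"] by auto
      have "dist y x < e" if y: "y \<in> \<Omega>" "\<bar>s y - c\<bar> < d/2" for y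
      proof -
        have "eventually (\<lambda>n. dist (s (u (r n))) c < d/2) sequentially"
          using tendstoD[OF zr, of "d/2"] d by simp
        moreover have "eventually (\<lambda>n. dist (u (r n)) x < e/2) sequentially"
          using tendstoD[OF x(3), of "e/2"] \<open>e > 0\<close> by simp
        ultimately have "eventually (\<lambda>n. dist (s (u (r n))) c < d/2 \<and> dist (u (r n)) x < e/2) sequentially"
          by (rule eventually_conj)
        then obtain n where n: "dist (s (u (r n))) c < d/2" "dist (u (r n)) x < e/2"
          using eventually_happens'[OF sequentially_bot] by blast
        have "\<bar>s y - s (u (r n))\<bar> < d" using n(1) y(2) unfolding dist_real_def by linarith
        then have "dist y (u (r n)) < e/2" using d(2) y(1) u(1) by blast
        then show ?thesis using n(2) by (metis dist_commute dist_triangle_half_l)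
      qed
      then show "\<exists>d>0. \<forall>y\<in>\<Omega>. \<bar>s y - c\<bar> < d \<longrightarrow> dist y x < e"
        using d(1) by (intro exI[of _ "d/2"]) auto
    qed
  qed
  then obtain \<psi> where \<psi>: "\<And>c. c \<in> ?C \<Longrightarrow> \<psi> c \<in> \<Omega>"
    "\<And>c e. c \<in> ?C \<Longrightarrow> e > 0 \<Longrightarrow> \<exists>d>0. \<forall>y\<in>\<Omega>. \<bar>s y - c\<bar> < d \<longrightarrow> dist y (\<psi> c) < e"
    by metis
  show thesis
  proof
    show "\<psi> ` ?C \<subseteq> \<Omega>" using \<psi>(1) by auto
    show "\<psi> (s x) = x" if x: "x \<in> \<Omega>" for x
    proof (rule ccontr)
      assume "\<psi> (s x) \<noteq> x"
      then have pos: "dist x (\<psi> (s x)) > 0" by auto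
      have "s x \<in> ?C" by (rule subsetD[OF closure_subset imageI[OF x]])
      from \<psi>(2)[OF this pos] x show False by auto
    qed
    show "continuous_on ?C \<psi>"
    proof (rule continuous_onI)
      fix c e :: real assume c: "c \<in> ?C" and "e > 0"
      then obtain d where d: "d > 0" "\<forall>y\<in>\<Omega>. \<bar>s y - c\<bar> < d \<longrightarrow> dist y (\<psi> c) < e/2"
        using \<psi>(2)[of c "e/2"] by auto
      have "dist (\<psi> c') (\<psi> c) \<le> e" if c': "c' \<in> ?C" "dist c' c < d/2" for c'
      proof -
        obtain d' where d': "d' > 0" "\<forall>y\<in>\<Omega>. \<bar>s y - c'\<bar> < d' \<longrightarrow> dist y (\<psi> c') < e/2"
          using \<psi>(2)[of c' "e/2"] c' \<open>e > 0\<close> by auto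
        have "min d' (d/2) > 0" using d d' by simp
        \<comment> \<open>One point \<open>y\<close> with code close to \<open>c'\<close>, hence
          also close to \<open>c\<close>, links \<open>\<psi> c\<close> and
          \<open>\<psi> c'\<close>. Halving \<open>d\<close> leaves room for the distance between
          \<open>c\<close> and \<open>c'\<close>.\<close>
        then obtain y where y: "y \<in> \<Omega>" "dist (s y) c' < min d' (d/2)"
          using c'(1) unfolding closure_approachable by (metis imageE)
        have "\<bar>s y - c\<bar> < d" "\<bar>s y - c'\<bar> < d'" using y(2) c'(2) unfolding dist_real_def by linarith+
        then have "dist y (\<psi> c) < e/2" "dist y (\<psi> c') < e/2" using d d' y(1) by auto
        then show ?thesis by (metis dist_triangle_half_r less_imp_le)
      qed
      then show "\<exists>d>0. \<forall>x'\<in>?C. dist x' c < d \<longrightarrow> dist (\<psi> x') (\<psi> c) \<le> e"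
        using d(1) by (intro exI[of _ "d/2"]) auto
    qed
  qed
qed

section \<open>Weak-* sequential compactness\<close>

text \<open>The measures are pushed to the real line by the code \<open>s\<close>, a weak limit
  \<open>M\<close> is taken there, and \<open>M\<close> is pulled back by the decoding map. Since
  \<open>s\<close> may be discontinuous, a test function \<open>g\<close> is not transported along
  \<open>s\<close>; instead \<open>g \<circ> \<psi>\<close> is extended continuously to the
  line.\<close>

lemma prob_measures_seq_compact:
  fixes \<Omega> :: "'a::metric_space set"
  assumes "compact \<Omega>" and \<mu>s: "\<And>n. \<mu>s n \<in> prob_measures \<Omega>"
  obtains r \<nu> where "strict_mono (r :: nat \<Rightarrow> nat)" "\<nu> \<in> prob_measures \<Omega>"
    "weak_star_conv \<Omega> (\<lambda>n. \<mu>s (r n)) \<nu>"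
proof -
  interpret P: prob_space "\<mu>s n" for n using prob_measuresD(1)[OF \<mu>s] .
  note sp = prob_measuresD(3)[OF \<mu>s]
  have "\<Omega> \<noteq> {}" using P.not_empty[of 0] sp by simp
  then obtain x0 where x0: "x0 \<in> \<Omega>" by blast
  obtain s :: "'a \<Rightarrow> real" where s: "s \<in> borel_measurable (restrict_space borel \<Omega>)"
    "\<And>x. s x \<in> {0..2}"
    "\<And>e. e > 0 \<Longrightarrow> \<exists>d>0. \<forall>x\<in>\<Omega>. \<forall>y\<in>\<Omega>. \<bar>s x - s y\<bar> < d \<longrightarrow> dist x y < e"
    using compact_borel_code[OF assms(1)] by metis
  define C where "C = closure (s ` \<Omega>)"
  have clC: "closed C" by (simp add: C_def)
  have sC: "s x \<in> C" if "x \<in> \<Omega>" for x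
    unfolding C_def by (rule subsetD[OF closure_subset imageI[OF that]])
  obtain \<psi> where \<psi>: "continuous_on C \<psi>" "\<psi> ` C \<subseteq> \<Omega>" "\<And>x. x \<in> \<Omega> \<Longrightarrow> \<psi> (s x) = x"
    using continuous_decoding[OF assms(1) s(3)] unfolding C_def by metis
  have sm[measurable]: "s \<in> borel_measurable (\<mu>s n)" for n
    using s(1) by (simp add: measurable_prob_measures_eq[OF \<mu>s])
  define N where "N n = distr (\<mu>s n) borel s" for n
  have rd: "real_distribution (N n)" for n
    unfolding real_distribution_def real_distribution_axioms_def N_def
    by (auto intro!: P.prob_space_distr)
  have "tight N"
    unfolding tight_def
  proof (intro conjI allI impI rd)
    fix \<epsilon> :: real assume "\<epsilon> > 0"
    \<comment> \<open>Codes lie in \<open>{0..2}\<close>; the left endpoint is -1 because the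
      interval is open on the left and must contain 0.\<close>
    have "measure (N n) {-1<..2} = 1" for n
    proof -
      have "s -` {-1<..2} \<inter> space (\<mu>s n) = space (\<mu>s n)" using s(2) by (force intro: less_le_trans[of "-1" 0])
      then show ?thesis unfolding N_def by (subst measure_distr) (auto simp: P.prob_space)
    qed
    then show "\<exists>a b. a < b \<and> (\<forall>n. 1 - \<epsilon> < measure (N n) {a<..b})"
      using \<open>\<epsilon> > 0\<close> by (intro exI[of _ "-1"] exI[of _ 2]) auto
  qed
  from tight_imp_convergent_subsubsequence[OF this strict_mono_id] obtain r M where
    r: "strict_mono (r :: nat \<Rightarrow> nat)" and M: "real_distribution M" and wc: "weak_conv_m (N \<circ> r) M"
    by auto
  interpret M: real_distribution M by fact
  have conv: "(\<lambda>n. \<integral>x. G (s x) \<partial>\<mu>s (r n)) \<longlonglongrightarrow> (\<integral>x. G x \<partial>M)"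
    if G: "continuous_on UNIV G" "\<And>x. \<bar>G x\<bar> \<le> K" for G :: "real \<Rightarrow> real" and K
  proof -
    have "(\<lambda>n. \<integral>x. G x \<partial>(N \<circ> r) n) \<longlonglongrightarrow> (\<integral>x. G x \<partial>M)"
    proof (rule weak_conv_imp_integral_bdd_continuous_conv[OF _ M wc])
      show "isCont G x" for x using G(1) by (simp add: continuous_on_eq_continuous_at)
    qed (use rd G(2) in auto)
    moreover have "(\<integral>x. G x \<partial>(N \<circ> r) n) = (\<integral>x. G (s x) \<partial>\<mu>s (r n))" for n
      unfolding N_def o_def
      by (rule integral_distr) (use borel_measurable_continuous_onI[OF G(1)] in auto)
    ultimately show ?thesis by simp
  qed
  \<comment> \<open>The limit \<open>M\<close> is concentrated on \<open>C\<close>: the truncated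
    distance to \<open>C\<close> is bounded and continuous and integrates to 0 against every pushed
    measure, hence also against \<open>M\<close>.\<close>
  have "(\<lambda>n. \<integral>x. min 1 (infdist (s x) C) \<partial>\<mu>s (r n)) \<longlonglongrightarrow> (\<integral>x. min 1 (infdist x C) \<partial>M)"
    by (rule conv[of _ 1]) (auto intro!: continuous_intros simp: infdist_nonneg)
  moreover have "(\<integral>x. min 1 (infdist (s x) C) \<partial>\<mu>s (r n)) = 0" for n
  proof -
    have "(\<integral>x. min 1 (infdist (s x) C) \<partial>\<mu>s (r n)) = (\<integral>x. 0 \<partial>\<mu>s (r n))"
      by (rule Bochner_Integration.integral_cong) (auto simp: sp sC)
    then show ?thesis by simp
  qed
  ultimately have "(\<integral>x. min 1 (infdist x C) \<partial>M) = 0"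
    by (simp add: LIMSEQ_const_iff)
  moreover have "integrable M (\<lambda>x. min 1 (infdist x C))"
  proof (rule M.integrable_const_bound[where B=1])
    have "(\<lambda>x. min 1 (infdist x C)) \<in> borel_measurable borel"
      by (intro borel_measurable_continuous_onI continuous_intros)
    then show "(\<lambda>x. min 1 (infdist x C)) \<in> borel_measurable M" by simp
  qed (auto simp: infdist_nonneg)
  ultimately have "AE x in M. min 1 (infdist x C) = 0"
    by (subst (asm) integral_nonneg_eq_0_iff_AE) (auto simp: infdist_nonneg)
  moreover have "C \<noteq> {}" using sC x0 by blast
  ultimately have AEC: "AE x in M. x \<in> C"
    by (rule_tac eventually_mono) (use clC in \<open>auto simp: in_closed_iff_infdist_zero min_def split: if_splits\<close>)
  \<comment> \<open>The value \<open>x0\<close> off \<open>C\<close> only makes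
    \<open>\<phi>\<close> a total Borel map into \<open>\<Omega>\<close>; the complement of
    \<open>C\<close> is null for \<open>M\<close>.\<close>
  define \<phi> where "\<phi> c = (if c \<in> C then \<psi> c else x0)" for c
  have "\<phi> \<in> borel_measurable borel"
    unfolding \<phi>_def
    using borel_measurable_continuous_on_restrict[OF \<psi>(1)] clC
    by (subst measurable_restrict_space_iff[symmetric]) auto
  then have \<phi>: "\<phi> \<in> M \<rightarrow>\<^sub>M restrict_space borel \<Omega>"
    using \<psi>(2) x0 by (intro measurable_restrict_space2) (auto simp: \<phi>_def image_subset_iff)
  define \<nu> where "\<nu> = distr M (restrict_space borel \<Omega>) \<phi>"
  show thesis
  proof
    show "strict_mono r" by fact
    show "\<nu> \<in> prob_measures \<Omega>"
      unfolding prob_measures_def \<nu>_def using M.prob_space_distr[OF \<phi>] by simp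
    show "weak_star_conv \<Omega> (\<lambda>n. \<mu>s (r n)) \<nu>"
      unfolding weak_star_conv_def
    proof (intro allI impI)
      fix g :: "'a \<Rightarrow> real" assume g: "continuous_on \<Omega> g"
      have "bounded (g ` \<Omega>)"
        using compact_continuous_image[OF g assms(1)] compact_imp_bounded by blast
      then obtain B where B: "B > 0" "\<And>x. x \<in> \<Omega> \<Longrightarrow> norm (g x) \<le> B"
        by (auto simp: bounded_pos)
      have "continuous_on C (\<lambda>c. g (\<psi> c))"
        using continuous_on_compose2[OF g \<psi>(1)] \<psi>(2) by blast
      \<comment> \<open>Tietze's theorem with the bound \<open>B\<close>, since \<open>conv\<close>
        needs a test function that is continuous and bounded on the whole line.\<close>
      then obtain G where G: "continuous_on UNIV G" "\<And>x. x \<in> C \<Longrightarrow> G x = g (\<psi> x)" "\<And>x. norm (G x) \<le> B"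
        using Tietze[of C "\<lambda>c. g (\<psi> c)" UNIV B] B clC \<psi>(2)
        by (metis UNIV_I closed_closedin image_subset_iff less_imp_le subtopology_UNIV)
      have "(\<lambda>n. \<integral>x. G (s x) \<partial>\<mu>s (r n)) \<longlonglongrightarrow> (\<integral>x. G x \<partial>M)"
        using G by (intro conv[of _ B]) auto
      moreover have "(\<integral>x. G (s x) \<partial>\<mu>s (r n)) = (\<integral>x. g x \<partial>\<mu>s (r n))" for n
        by (rule Bochner_Integration.integral_cong) (auto simp: sp sC G \<psi>(3))
      moreover have "(\<integral>x. g x \<partial>\<nu>) = (\<integral>x. G x \<partial>M)"
      proof -
        have gm: "g \<in> borel_measurable (restrict_space borel \<Omega>)"
          by (rule borel_measurable_continuous_on_restrict[OF g])
        have "(\<integral>x. g x \<partial>\<nu>) = (\<integral>c. g (\<phi> c) \<partial>M)"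
          unfolding \<nu>_def by (rule integral_distr[OF \<phi> gm])
        also have "\<dots> = (\<integral>c. G c \<partial>M)"
        proof (rule integral_cong_AE)
          show "(\<lambda>c. g (\<phi> c)) \<in> borel_measurable M" using measurable_compose[OF \<phi> gm] .
          show "G \<in> borel_measurable M" using borel_measurable_continuous_onI[OF G(1)] by simp
          show "AE c in M. g (\<phi> c) = G c" using AEC by eventually_elim (simp add: \<phi>_def G)
        qed
        finally show ?thesis .
      qed
      ultimately show "(\<lambda>n. \<integral>x. g x \<partial>\<mu>s (r n)) \<longlonglongrightarrow> (\<integral>x. g x \<partial>\<nu>)" by simp
    qed
  qed
qed

section \<open>Countable families of test functions\<close>

text \<open>\<open>U\<close> consists of partitions of unity subordinate to finite covers by balls of radius \<open>1/(n+1)\<close>.\<close>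

lemma countable_spanning_functions:
  fixes \<Omega> :: "'a::metric_space set"
  assumes "compact \<Omega>" "\<Omega> \<noteq> {}"
  obtains U :: "('a \<Rightarrow> real) set" where "countable U" "U \<noteq> {}" "\<And>u. u \<in> U \<Longrightarrow> continuous_on \<Omega> u"
    "\<And>\<phi> e. continuous_on \<Omega> \<phi> \<Longrightarrow> e > 0 \<Longrightarrow>
      \<exists>F a. finite F \<and> F \<subseteq> U \<and> (\<forall>x\<in>\<Omega>. \<bar>\<phi> x - (\<Sum>u\<in>F. a u * u x)\<bar> \<le> e)"
proof -
  obtain X where X: "\<And>n. finite (X n)" "\<And>n. X n \<subseteq> \<Omega>" "\<And>n. \<Omega> \<subseteq> (\<Union>x\<in>X n. ball x (1 / real (Suc n)))"
    using compact_finite_nets[OF assms(1)] by metis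
  define b where "b n x y = max 0 (1 / real (Suc n) - dist x y)" for n :: nat and x y :: 'a
  define S where "S n y = (\<Sum>x\<in>X n. b n x y)" for n y
  define u where "u n x y = b n x y / S n y" for n x y
  define U where "U = (\<Union>n. u n ` X n)"
  have b0: "b n x y \<ge> 0" for n x y by (simp add: b_def)
  have S0: "S n y > 0" if "y \<in> \<Omega>" for n y
  proof -
    from that X(3)[of n] obtain x where "x \<in> X n" "y \<in> ball x (1 / real (Suc n))" by blast
    then have "0 < b n x y" "x \<in> X n" by (auto simp: b_def)
    then show ?thesis unfolding S_def by (intro sum_pos2[OF X(1)]) (auto simp: b0)
  qed
  have cb: "continuous_on \<Omega> (b n x)" for n x unfolding b_def by (intro continuous_intros)
  have cS: "continuous_on \<Omega> (S n)" for n unfolding S_def by (intro continuous_intros cb)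
  have cu: "continuous_on \<Omega> (u n x)" for n x
    unfolding u_def using S0 by (intro continuous_intros cb cS) (metis less_irrefl)
  show thesis
  proof
    show "countable U" unfolding U_def using X(1) by (intro countable_UN) (auto intro: countable_finite)
    have "X 0 \<noteq> {}" using X(3)[of 0] assms(2) by auto
    then show "U \<noteq> {}" unfolding U_def by blast
    show "continuous_on \<Omega> w" if "w \<in> U" for w using that cu unfolding U_def by auto
    fix \<phi> :: "'a \<Rightarrow> real" and e :: real assume \<phi>: "continuous_on \<Omega> \<phi>" and "e > 0"
    have "uniformly_continuous_on \<Omega> \<phi>" using compact_uniformly_continuous[OF \<phi> assms(1)] .
    then obtain d where d: "d > 0" "\<And>x y. x \<in> \<Omega> \<Longrightarrow> y \<in> \<Omega> \<Longrightarrow> dist x y < d \<Longrightarrow> \<bar>\<phi> x - \<phi> y\<bar> < e"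
      unfolding uniformly_continuous_on_def dist_real_def using \<open>e > 0\<close> by metis
    obtain n where n: "1 / real (Suc n) < d" using nat_approx_posE[OF d(1)] by auto
    \<comment> \<open>Different centres may give the same function \<open>w\<close>; summing
      \<open>\<phi>\<close> over all of them turns the sum over functions into the sum over
      centres.\<close>
    define a where "a w = (\<Sum>x | x \<in> X n \<and> u n x = w. \<phi> x)" for w
    have sum_eq: "(\<Sum>w\<in>u n ` X n. a w * w y) = (\<Sum>x\<in>X n. \<phi> x * u n x y)" for y
      unfolding a_def sum_distrib_right
      by (subst sum.image_gen[OF X(1), of _ _ "u n"]) (auto intro!: sum.cong)
    have "\<bar>\<phi> y - (\<Sum>w\<in>u n ` X n. a w * w y)\<bar> \<le> e" if y: "y \<in> \<Omega>" for y
    proof -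
      have one: "(\<Sum>x\<in>X n. u n x y) = 1"
        using S0[OF y, of n] by (simp add: u_def S_def flip: sum_divide_distrib)
      have u0: "u n x y \<ge> 0" for x using S0[OF y, of n] by (simp add: u_def b0)
      have "\<phi> y - (\<Sum>x\<in>X n. \<phi> x * u n x y) = (\<Sum>x\<in>X n. (\<phi> y - \<phi> x) * u n x y)"
        by (simp add: left_diff_distrib sum_subtractf one flip: sum_distrib_left)
      also have "\<bar>\<dots>\<bar> \<le> (\<Sum>x\<in>X n. e * u n x y)"
      proof (rule order_trans[OF sum_abs sum_mono])
        fix x assume x: "x \<in> X n"
        show "\<bar>(\<phi> y - \<phi> x) * u n x y\<bar> \<le> e * u n x y"
        proof (cases "dist x y < 1 / real (Suc n)")
          case True
          then have "\<bar>\<phi> y - \<phi> x\<bar> < e" using d(2)[of y x] y x X(2) n by (auto simp: dist_commute)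
          then show ?thesis using u0 by (simp add: abs_mult mult_right_mono)
        next
          case False
          then show ?thesis by (simp add: u_def b_def)
        qed
      qed
      also have "\<dots> = e" using one by (simp flip: sum_distrib_left)
      finally show ?thesis by (simp add: sum_eq)
    qed
    then show "\<exists>F a. finite F \<and> F \<subseteq> U \<and> (\<forall>x\<in>\<Omega>. \<bar>\<phi> x - (\<Sum>w\<in>F. a w * w x)\<bar> \<le> e)"
      using X(1) by (intro exI[of _ "u n ` X n"] exI[of _ a]) (auto simp: U_def)
  qed
qed

lemma tendsto_integral_uniform_limit:
  fixes \<phi> :: "'a::metric_space \<Rightarrow> real"
  assumes "compact \<Omega>" "\<And>n. \<mu>s n \<in> prob_measures \<Omega>" "\<mu> \<in> prob_measures \<Omega>" "continuous_on \<Omega> \<phi>"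
    and approx: "\<And>e. e > 0 \<Longrightarrow> \<exists>w. continuous_on \<Omega> w \<and> (\<forall>x\<in>\<Omega>. \<bar>\<phi> x - w x\<bar> \<le> e) \<and>
      (\<lambda>n. \<integral>x. w x \<partial>\<mu>s n) \<longlonglongrightarrow> (\<integral>x. w x \<partial>\<mu>)"
  shows "(\<lambda>n. \<integral>x. \<phi> x \<partial>\<mu>s n) \<longlonglongrightarrow> (\<integral>x. \<phi> x \<partial>\<mu>)"
proof (rule LIMSEQ_I)
  fix e :: real assume "e > 0"
  then obtain w where w: "continuous_on \<Omega> w" "\<And>x. x \<in> \<Omega> \<Longrightarrow> \<bar>\<phi> x - w x\<bar> \<le> e/4"
    "(\<lambda>n. \<integral>x. w x \<partial>\<mu>s n) \<longlonglongrightarrow> (\<integral>x. w x \<partial>\<mu>)"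
    using approx[of "e/4"] by auto
  have d: "\<bar>(\<integral>x. \<phi> x \<partial>\<nu>) - (\<integral>x. w x \<partial>\<nu>)\<bar> \<le> e/4" if "\<nu> \<in> prob_measures \<Omega>" for \<nu>
    using integral_diff_le_prob_measures[OF assms(1,4) w(1) that w(2)] .
  obtain N where N: "\<And>n. n \<ge> N \<Longrightarrow> norm ((\<integral>x. w x \<partial>\<mu>s n) - (\<integral>x. w x \<partial>\<mu>)) < e/4"
    using LIMSEQ_D[OF w(3), of "e/4"] \<open>e > 0\<close> by auto
  have "norm ((\<integral>x. \<phi> x \<partial>\<mu>s n) - (\<integral>x. \<phi> x \<partial>\<mu>)) < e" if "n \<ge> N" for n
    using d[OF assms(2)[of n]] d[OF assms(3)] N[OF that] \<open>e > 0\<close> unfolding real_norm_def by linarith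
  then show "\<exists>N. \<forall>n\<ge>N. norm ((\<integral>x. \<phi> x \<partial>\<mu>s n) - (\<integral>x. \<phi> x \<partial>\<mu>)) < e" by blast
qed

text \<open>Each \<open>u\<close> of the countable spanning family is approximated by elements
  \<open>G u m\<close> of \<open>V\<close>, and these form the test sequence. Convergence of
  integrals passes to \<open>U\<close> by uniform approximation, to finite linear combinations by
  linearity, and to all continuous functions by uniform approximation again.\<close>

lemma weak_star_test_sequence:
  fixes \<Omega> :: "'a::metric_space set"
  assumes "compact \<Omega>" "\<Omega> \<noteq> {}" "uniformly_dense \<Omega> V" "V \<subseteq> {g. continuous_on \<Omega> g}"
  obtains w :: "nat \<Rightarrow> 'a \<Rightarrow> real" where "\<And>i. w i \<in> V"
    "\<And>\<mu>s \<mu>. (\<And>n. \<mu>s n \<in> prob_measures \<Omega>) \<Longrightarrow> \<mu> \<in> prob_measures \<Omega> \<Longrightarrow>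
      (\<And>i. (\<lambda>n. \<integral>x. w i x \<partial>\<mu>s n) \<longlonglongrightarrow> (\<integral>x. w i x \<partial>\<mu>)) \<Longrightarrow> weak_star_conv \<Omega> \<mu>s \<mu>"
proof -
  obtain U :: "('a \<Rightarrow> real) set" where U: "countable U" "U \<noteq> {}" "\<And>u. u \<in> U \<Longrightarrow> continuous_on \<Omega> u"
    "\<And>\<phi> e. continuous_on \<Omega> \<phi> \<Longrightarrow> e > 0 \<Longrightarrow>
      \<exists>F a. finite F \<and> F \<subseteq> U \<and> (\<forall>x\<in>\<Omega>. \<bar>\<phi> x - (\<Sum>u\<in>F. a u * u x)\<bar> \<le> e)"
    by (rule countable_spanning_functions[OF assms(1,2)]) (rule that)
  define G where "G u m = (SOME g. g \<in> V \<and> (\<forall>x\<in>\<Omega>. \<bar>u x - g x\<bar> < 1 / real (Suc m)))" for u m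
  have "G u m \<in> V \<and> (\<forall>x\<in>\<Omega>. \<bar>u x - G u m x\<bar> < 1 / real (Suc m))" if "u \<in> U" for u m
  proof -
    have "0 < 1 / real (Suc m)" by simp
    from assms(3)[unfolded uniformly_dense_def, rule_format, OF U(3)[OF that] this]
    show ?thesis unfolding G_def Bex_def by (rule someI_ex)
  qed
  then have G: "\<And>u m. u \<in> U \<Longrightarrow> G u m \<in> V"
    "\<And>u m x. u \<in> U \<Longrightarrow> x \<in> \<Omega> \<Longrightarrow> \<bar>u x - G u m x\<bar> < 1 / real (Suc m)"
    by blast+
  define D where "D = (\<lambda>(u, m). G u m) ` (U \<times> (UNIV :: nat set))"
  have D: "countable D" "D \<noteq> {}" using U(1,2) by (auto simp: D_def)
  have rw: "range (from_nat_into D) = D" using range_from_nat_into[OF D(2,1)] .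
  show thesis
  proof
    show "from_nat_into D i \<in> V" for i
      using from_nat_into[OF D(2), of i] G(1) by (auto simp: D_def)
    fix \<mu>s and \<mu> :: "'a measure"
    assume \<mu>s: "\<And>n. \<mu>s n \<in> prob_measures \<Omega>" and \<mu>: "\<mu> \<in> prob_measures \<Omega>"
      and conv: "\<And>i. (\<lambda>n. \<integral>x. from_nat_into D i x \<partial>\<mu>s n) \<longlonglongrightarrow> (\<integral>x. from_nat_into D i x \<partial>\<mu>)"
    have convD: "(\<lambda>n. \<integral>x. g x \<partial>\<mu>s n) \<longlonglongrightarrow> (\<integral>x. g x \<partial>\<mu>)" if "g \<in> D" for g
    proof -
      from that rw obtain i where "g = from_nat_into D i" by auto
      then show ?thesis using conv[of i] by simp
    qed
    have convU: "(\<lambda>n. \<integral>x. u x \<partial>\<mu>s n) \<longlonglongrightarrow> (\<integral>x. u x \<partial>\<mu>)" if u: "u \<in> U" for u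
    proof (rule tendsto_integral_uniform_limit[OF assms(1) \<mu>s \<mu> U(3)[OF u]])
      fix e :: real assume "e > 0"
      then obtain m where m: "1 / real (Suc m) < e" using nat_approx_posE by auto
      have "\<forall>x\<in>\<Omega>. \<bar>u x - G u m x\<bar> \<le> e" using G(2)[OF u, of _ m] m by fastforce
      moreover have "G u m \<in> D" using u by (auto simp: D_def)
      ultimately show "\<exists>w. continuous_on \<Omega> w \<and> (\<forall>x\<in>\<Omega>. \<bar>u x - w x\<bar> \<le> e) \<and>
          (\<lambda>n. \<integral>x. w x \<partial>\<mu>s n) \<longlonglongrightarrow> (\<integral>x. w x \<partial>\<mu>)"
        using convD G(1)[OF u, of m] assms(4) by blast
    qed
    show "weak_star_conv \<Omega> \<mu>s \<mu>"
      unfolding weak_star_conv_def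
    proof (intro allI impI)
      fix \<phi> :: "'a \<Rightarrow> real" assume \<phi>: "continuous_on \<Omega> \<phi>"
      show "(\<lambda>n. \<integral>x. \<phi> x \<partial>\<mu>s n) \<longlonglongrightarrow> (\<integral>x. \<phi> x \<partial>\<mu>)"
      proof (rule tendsto_integral_uniform_limit[OF assms(1) \<mu>s \<mu> \<phi>])
        fix e :: real assume "e > 0"
        from U(4)[OF \<phi> this] obtain F a where F: "finite F" "F \<subseteq> U" "\<forall>x\<in>\<Omega>. \<bar>\<phi> x - (\<Sum>u\<in>F. a u * u x)\<bar> \<le> e"
          by (elim exE conjE) (rule that)
        have int: "(\<integral>x. (\<Sum>u\<in>F. a u * u x) \<partial>\<nu>) = (\<Sum>u\<in>F. a u * (\<integral>x. u x \<partial>\<nu>))"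
          if "\<nu> \<in> prob_measures \<Omega>" for \<nu>
          using integrable_continuous_on_prob_measures[OF assms(1) U(3) that] F(2)
          by (subst Bochner_Integration.integral_sum) auto
        have "continuous_on \<Omega> (\<lambda>x. \<Sum>u\<in>F. a u * u x)"
          using U(3) F(2) by (intro continuous_intros) auto
        moreover have "(\<lambda>n. \<integral>x. (\<Sum>u\<in>F. a u * u x) \<partial>\<mu>s n) \<longlonglongrightarrow> (\<integral>x. (\<Sum>u\<in>F. a u * u x) \<partial>\<mu>)"
          unfolding int[OF \<mu>s] int[OF \<mu>]
          using convU F(2) by (intro tendsto_intros) auto
        ultimately show "\<exists>w. continuous_on \<Omega> w \<and> (\<forall>x\<in>\<Omega>. \<bar>\<phi> x - w x\<bar> \<le> e) \<and>
          (\<lambda>n. \<integral>x. w x \<partial>\<mu>s n) \<longlonglongrightarrow> (\<integral>x. w x \<partial>\<mu>)"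
          using F(3) by (intro exI[of _ "\<lambda>x. \<Sum>u\<in>F. a u * u x"] conjI)
      qed
    qed
  qed
qed

section \<open>Invariant measures and entropy\<close>

lemma act_continuous:
  assumes "cont_action \<Omega> l T"
  shows "continuous_on \<Omega> (act l T v)" "act l T v ` \<Omega> \<subseteq> \<Omega>"
proof -
  have T: "continuous_on \<Omega> (T i)" "T i ` \<Omega> \<subseteq> \<Omega>" if "i < l" for i
    using assms that by (auto simp: cont_action_def)
  have pow: "continuous_on \<Omega> (T i ^^ n) \<and> (T i ^^ n) ` \<Omega> \<subseteq> \<Omega>" if "i < l" for i n
  proof (induction n)
    case (Suc n)
    then have "continuous_on \<Omega> (T i \<circ> (T i ^^ n))"
      using continuous_on_compose[of \<Omega> "T i ^^ n" "T i"] continuous_on_subset[OF T(1)[OF that]] by blast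
    moreover have "(T i \<circ> (T i ^^ n)) ` \<Omega> \<subseteq> \<Omega>" using Suc T(2)[OF that] by fastforce
    ultimately show ?case by simp
  qed auto
  have "continuous_on \<Omega> (foldr (\<lambda>i g. (T i ^^ v i) \<circ> g) is id) \<and>
      foldr (\<lambda>i g. (T i ^^ v i) \<circ> g) is id ` \<Omega> \<subseteq> \<Omega>" if "set is \<subseteq> {..<l}" for "is"
    using that
  proof (induction "is")
    case (Cons i "is")
    let ?F = "foldr (\<lambda>i g. (T i ^^ v i) \<circ> g) is id"
    have i: "i < l" and sub: "set is \<subseteq> {..<l}" using Cons.prems by auto
    note IH = conjunct1[OF Cons.IH[OF sub]] conjunct2[OF Cons.IH[OF sub]]
    have "continuous_on \<Omega> ((T i ^^ v i) \<circ> ?F)"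
      using continuous_on_compose[OF IH(1)] continuous_on_subset IH(2) pow[OF i] by blast
    moreover have "((T i ^^ v i) \<circ> ?F) ` \<Omega> \<subseteq> \<Omega>" using IH(2) pow[OF i, of "v i"]
      unfolding image_comp[symmetric] by (meson image_mono order_trans)
    moreover have "foldr (\<lambda>i g. (T i ^^ v i) \<circ> g) (i # is) id = (T i ^^ v i) \<circ> ?F" by simp
    ultimately show ?case by (simp only: conj_absorb simp_thms)
  qed auto
  then show "continuous_on \<Omega> (act l T v)" "act l T v ` \<Omega> \<subseteq> \<Omega>"
    unfolding act_def by (metis atLeast_upt order_refl)+
qed

lemma act_measurable:
  assumes "cont_action \<Omega> l T" "\<mu> \<in> prob_measures \<Omega>"
  shows "act l T v \<in> \<mu> \<rightarrow>\<^sub>M restrict_space borel \<Omega>"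
  unfolding measurable_prob_measures_eq[OF assms(2)]
  using act_continuous[OF assms(1), of v]
  by (intro measurable_restrict_space2 borel_measurable_continuous_on_restrict)
    (auto simp: space_restrict_space)

text \<open>Invariance as an equality of measures can be verified with continuous test functions
  through \<open>prob_measures_eqI\<close>.\<close>

lemma inv_measures_iff_distr:
  assumes "cont_action \<Omega> l T" "\<mu> \<in> prob_measures \<Omega>"
  shows "\<mu> \<in> inv_measures \<Omega> l T \<longleftrightarrow>
    (\<forall>v\<in>vecs l. distr \<mu> (restrict_space borel \<Omega>) (act l T v) = \<mu>)"
proof -
  interpret prob_space \<mu> using prob_measuresD(1)[OF assms(2)] .
  note m = act_measurable[OF assms] and s = prob_measuresD(2)[OF assms(2)]
    and sp = prob_measuresD(3)[OF assms(2)]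
  have "distr \<mu> (restrict_space borel \<Omega>) (act l T v) = \<mu> \<longleftrightarrow>
      (\<forall>A\<in>sets \<mu>. measure \<mu> (act l T v -` A \<inter> \<Omega>) = measure \<mu> A)" (is "?D = \<mu> \<longleftrightarrow> _") for v
  proof
    assume eq: "?D = \<mu>"
    show "\<forall>A\<in>sets \<mu>. measure \<mu> (act l T v -` A \<inter> \<Omega>) = measure \<mu> A"
    proof
      fix A assume "A \<in> sets \<mu>"
      then have "measure ?D A = measure \<mu> (act l T v -` A \<inter> space \<mu>)"
        by (intro measure_distr[OF m]) (simp add: s)
      then show "measure \<mu> (act l T v -` A \<inter> \<Omega>) = measure \<mu> A" using eq sp by simp
    qed
  next
    assume A: "\<forall>A\<in>sets \<mu>. measure \<mu> (act l T v -` A \<inter> \<Omega>) = measure \<mu> A"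
    show "?D = \<mu>"
    proof (rule measure_eqI)
      fix B assume "B \<in> sets ?D"
      then have B: "B \<in> sets \<mu>" "B \<in> sets (restrict_space borel \<Omega>)" by (simp_all add: s)
      show "emeasure ?D B = emeasure \<mu> B"
        using A B(1) by (subst emeasure_distr[OF m B(2)]) (simp add: emeasure_eq_measure sp)
    qed (simp add: s)
  qed
  then show ?thesis using assms(2) by (simp add: inv_measures_def)
qed

text \<open>For continuous \<open>g\<close> the function \<open>g \<circ> act l T v\<close> is again
  continuous on \<open>\<Omega>\<close>. Its integrals and those of \<open>g\<close> agree along the
  sequence, so their limits agree, and continuous functions determine the pushed-forward limit
  measure.\<close>

lemma inv_measures_closed:
  fixes \<Omega> :: "'a::metric_space set"
  assumes "compact \<Omega>" "cont_action \<Omega> l T" "\<And>n. \<mu>s n \<in> inv_measures \<Omega> l T"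
    and "\<nu> \<in> prob_measures \<Omega>" "weak_star_conv \<Omega> \<mu>s \<nu>"
  shows "\<nu> \<in> inv_measures \<Omega> l T"
proof -
  have pm: "\<mu>s n \<in> prob_measures \<Omega>" for n using assms(3) by (simp add: inv_measures_def)
  interpret N: prob_space \<nu> using prob_measuresD(1)[OF assms(4)] .
  have "distr \<nu> (restrict_space borel \<Omega>) (act l T v) = \<nu>" (is "?D = \<nu>") if v: "v \<in> vecs l" for v
  proof (rule prob_measures_eqI[OF assms(1) _ assms(4)])
    show "?D \<in> prob_measures \<Omega>"
      unfolding prob_measures_def using N.prob_space_distr[OF act_measurable[OF assms(2,4)]] by simp
    fix g :: "'a \<Rightarrow> real" assume g: "continuous_on \<Omega> g"
    have gm: "g \<in> borel_measurable (restrict_space borel \<Omega>)"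
      by (rule borel_measurable_continuous_on_restrict[OF g])
    have ga: "continuous_on \<Omega> (\<lambda>x. g (act l T v x))"
      using continuous_on_compose2[OF g] act_continuous[OF assms(2)] by blast
    have "(\<integral>x. g (act l T v x) \<partial>\<mu>s n) = (\<integral>x. g x \<partial>\<mu>s n)" for n
      using integral_distr[OF act_measurable[OF assms(2) pm] gm, of n v]
        inv_measures_iff_distr[OF assms(2) pm] assms(3) v by simp
    moreover have "(\<lambda>n. \<integral>x. h x \<partial>\<mu>s n) \<longlonglongrightarrow> (\<integral>x. h x \<partial>\<nu>)" if "continuous_on \<Omega> h" for h :: "'a \<Rightarrow> real"
      using assms(5) that by (simp add: weak_star_conv_def)
    from this[OF g] this[OF ga] have "(\<lambda>n. \<integral>x. g x \<partial>\<mu>s n) \<longlonglongrightarrow> (\<integral>x. g x \<partial>\<nu>)"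
      "(\<lambda>n. \<integral>x. g (act l T v x) \<partial>\<mu>s n) \<longlonglongrightarrow> (\<integral>x. g (act l T v x) \<partial>\<nu>)" .
    ultimately have "(\<integral>x. g (act l T v x) \<partial>\<nu>) = (\<integral>x. g x \<partial>\<nu>)"
      by (simp add: LIMSEQ_unique)
    then show "(\<integral>x. g x \<partial>?D) = (\<integral>x. g x \<partial>\<nu>)"
      using integral_distr[OF act_measurable[OF assms(2,4)] gm] by simp
  qed
  then show ?thesis using inv_measures_iff_distr[OF assms(2,4)] by blast
qed

text \<open>The trivial partition \<open>{\<Omega>}\<close> has entropy rate 0. Together with
  finiteness from above this makes the entropy a real number.\<close>

lemma KS_entropy_nonneg:
  assumes "cont_action \<Omega> l T" "\<mu> \<in> prob_measures \<Omega>"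
  shows "0 \<le> KS_entropy \<Omega> l T \<mu>"
proof -
  interpret prob_space \<mu> using prob_measuresD(1)[OF assms(2)] .
  have "join_box \<Omega> l T n {\<Omega>} = {\<Omega>}" for n
  proof -
    have "\<Omega> \<inter> (\<Inter>v\<in>box_l l n. act l T v -` a v) = \<Omega>" if "a \<in> box_l l n \<rightarrow>\<^sub>E {\<Omega>}" for a
      using that act_continuous(2)[OF assms(1)] by (fastforce simp: PiE_def Pi_def)
    moreover have "(\<lambda>v\<in>box_l l n. \<Omega>) \<in> box_l l n \<rightarrow>\<^sub>E {\<Omega>}" by auto
    ultimately show ?thesis unfolding join_box_def by (auto intro!: exI[of _ "\<lambda>v\<in>box_l l n. \<Omega>"])
  qed
  moreover have "measure \<mu> \<Omega> = 1" using prob_space prob_measuresD(3)[OF assms(2)] by simp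
  ultimately have "part_ent_rate \<Omega> l T \<mu> {\<Omega>} = 0"
    unfolding part_ent_rate_def part_entropy_def by (simp add: eta_def limI)
  moreover have "{\<Omega>} \<in> meas_partitions \<Omega>"
    unfolding meas_partitions_def
    using sets.top[of "restrict_space borel \<Omega>"] by (simp add: space_restrict_space)
  ultimately show ?thesis
    unfolding KS_entropy_def by (metis (no_types, lifting) SUP_upper zero_ereal_def)
qed

section \<open>Variational argument\<close>

text \<open>The dynamics are condensed into a set \<open>M\<close> and a real-valued function
  \<open>H\<close> on it. Upper semicontinuity is phrased for sequences whose entropies converge,
  which is the situation produced by a convergent pressure.\<close>

locale unique_equilibria =
  fixes \<Omega> :: "'a::metric_space set" and M :: "'a measure set" and H :: "'a measure \<Rightarrow> real"
    and f :: "'a \<Rightarrow> real" and V :: "('a \<Rightarrow> real) set"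
  assumes compact: "compact \<Omega>"
    and M_prob: "M \<subseteq> prob_measures \<Omega>"
    and M_compact: "\<And>\<mu>s. (\<And>n. \<mu>s n \<in> M) \<Longrightarrow>
      \<exists>r \<nu>. strict_mono (r :: nat \<Rightarrow> nat) \<and> \<nu> \<in> M \<and> weak_star_conv \<Omega> (\<lambda>n. \<mu>s (r n)) \<nu>"
    and H_usc: "\<And>\<mu>s \<mu> L. (\<And>n. \<mu>s n \<in> M) \<Longrightarrow> \<mu> \<in> M \<Longrightarrow> weak_star_conv \<Omega> \<mu>s \<mu> \<Longrightarrow>
      (\<lambda>n. H (\<mu>s n)) \<longlonglongrightarrow> L \<Longrightarrow> L \<le> H \<mu>"
    and f_cont: "continuous_on \<Omega> f"
    and V: "C_subspace \<Omega> V"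
    and unique: "\<And>g. g \<in> V \<Longrightarrow> \<exists>!\<nu>. \<nu> \<in> M \<and>
      (\<forall>\<nu>'\<in>M. (\<integral>x. f x + g x \<partial>\<nu>') + H \<nu>' \<le> (\<integral>x. f x + g x \<partial>\<nu>) + H \<nu>)"
begin

definition eqst :: "('a \<Rightarrow> real) \<Rightarrow> 'a measure" where
  "eqst g = (THE \<nu>. \<nu> \<in> M \<and>
    (\<forall>\<nu>'\<in>M. (\<integral>x. f x + g x \<partial>\<nu>') + H \<nu>' \<le> (\<integral>x. f x + g x \<partial>\<nu>) + H \<nu>))"

text \<open>The pressure of \<open>f + g\<close>, taken as the attained value and not as a supremum:
  it is real without a boundedness condition. For \<open>g\<close> in \<open>V\<close> it is the
  maximum, by \<open>le_P\<close>.\<close>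

definition P :: "('a \<Rightarrow> real) \<Rightarrow> real" where
  "P g = (\<integral>x. f x + g x \<partial>eqst g) + H (eqst g)"

lemma V_cont: "g \<in> V \<Longrightarrow> continuous_on \<Omega> g"
  using V by (auto simp: C_subspace_def)

lemma V_zero: "(\<lambda>x. 0) \<in> V"
  using V by (auto simp: C_subspace_def)

lemma V_add_mult: "g \<in> V \<Longrightarrow> w \<in> V \<Longrightarrow> (\<lambda>x. g x + c * w x) \<in> V"
  using V by (auto simp: C_subspace_def)

lemma V_sum:
  assumes "\<And>i. i < k \<Longrightarrow> w i \<in> V"
  shows "(\<lambda>x. \<Sum>i<k::nat. c i * w i x) \<in> V"
  using assms
proof (induction k)
  case (Suc k)
  then show ?case using V_add_mult[of "\<lambda>x. \<Sum>i<k. c i * w i x" "w k" "c k"] by simp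
qed (simp add: V_zero)

lemma integrable_M: "continuous_on \<Omega> g \<Longrightarrow> \<nu> \<in> M \<Longrightarrow> integrable \<nu> (g :: 'a \<Rightarrow> real)"
  using integrable_continuous_on_prob_measures[OF compact] M_prob by blast

lemma eqst_max: "g \<in> V \<Longrightarrow> eqst g \<in> M \<and> (\<forall>\<nu>\<in>M. (\<integral>x. f x + g x \<partial>\<nu>) + H \<nu> \<le> P g)"
  using theI'[OF unique] unfolding eqst_def[symmetric] P_def[symmetric] by blast

lemma eqst_in: "g \<in> V \<Longrightarrow> eqst g \<in> M"
  using eqst_max by blast

lemma le_P: "g \<in> V \<Longrightarrow> \<nu> \<in> M \<Longrightarrow> (\<integral>x. f x + g x \<partial>\<nu>) + H \<nu> \<le> P g"
  using eqst_max by blast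

lemma eqst_eqI:
  assumes "g \<in> V" "\<nu> \<in> M" "P g \<le> (\<integral>x. f x + g x \<partial>\<nu>) + H \<nu>"
  shows "eqst g = \<nu>"
  unfolding eqst_def
proof (rule the1_equality[OF unique[OF assms(1)]])
  show "\<nu> \<in> M \<and> (\<forall>\<nu>'\<in>M. (\<integral>x. f x + g x \<partial>\<nu>') + H \<nu>' \<le> (\<integral>x. f x + g x \<partial>\<nu>) + H \<nu>)"
    using assms le_P[OF assms(1)] by fastforce
qed

lemma integral_add_mult:
  assumes "g \<in> V" "w \<in> V" "\<nu> \<in> M"
  shows "(\<integral>x. f x + (g x + c * w x) \<partial>\<nu>) = (\<integral>x. f x + g x \<partial>\<nu>) + c * (\<integral>x. w x \<partial>\<nu>)"
proof -
  have "integrable \<nu> (\<lambda>x. f x + g x)" "integrable \<nu> (\<lambda>x. c * w x)"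
    by (intro integrable_M continuous_intros f_cont V_cont assms)+
  then have "(\<integral>x. (f x + g x) + c * w x \<partial>\<nu>) = (\<integral>x. f x + g x \<partial>\<nu>) + (\<integral>x. c * w x \<partial>\<nu>)"
    by (rule Bochner_Integration.integral_add)
  then show ?thesis by (simp add: add.assoc)
qed

lemma P_le_add:
  assumes "g \<in> V" "h \<in> V" "\<And>x. x \<in> \<Omega> \<Longrightarrow> \<bar>g x - h x\<bar> \<le> e"
  shows "P g \<le> P h + e"
proof -
  have "\<bar>(\<integral>x. f x + g x \<partial>eqst g) - (\<integral>x. f x + h x \<partial>eqst g)\<bar> \<le> e"
    using assms(3) eqst_in[OF assms(1)] M_prob
    by (intro integral_diff_le_prob_measures[OF compact] continuous_intros f_cont V_cont assms) auto
  then show ?thesis using le_P[OF assms(2) eqst_in[OF assms(1)]] unfolding P_def[of g] by linarith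
qed

lemma P_lipschitz:
  assumes "g \<in> V" "h \<in> V" "\<And>x. x \<in> \<Omega> \<Longrightarrow> \<bar>g x - h x\<bar> \<le> e"
  shows "\<bar>P g - P h\<bar> \<le> e"
  using P_le_add[OF assms] P_le_add[OF assms(2,1), of e] assms(3) by (fastforce simp: abs_minus_commute)

lemma V_bounded:
  assumes "w \<in> V"
  obtains B where "B \<ge> 0" "\<And>x. x \<in> \<Omega> \<Longrightarrow> \<bar>w x\<bar> \<le> B"
proof -
  have "bounded (w ` \<Omega>)"
    using compact_continuous_image[OF V_cont[OF assms] compact] compact_imp_bounded by blast
  then obtain B where "B > 0" "\<And>x. x \<in> \<Omega> \<Longrightarrow> norm (w x) \<le> B"
    by (auto simp: bounded_pos)
  then show thesis using that[of B] by auto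
qed

section \<open>The derivative of the pressure along a direction in V\<close>

lemma P_add_mult:
  assumes "g \<in> V" "w \<in> V"
  shows "P (\<lambda>x. g x + c * w x) = (\<integral>x. f x + g x \<partial>eqst (\<lambda>x. g x + c * w x)) +
    c * (\<integral>x. w x \<partial>eqst (\<lambda>x. g x + c * w x)) + H (eqst (\<lambda>x. g x + c * w x))"
  unfolding P_def[of "\<lambda>x. g x + c * w x"]
  by (subst integral_add_mult[OF assms eqst_in[OF V_add_mult[OF assms]]]) simp

text \<open>By compactness the equilibrium states of \<open>g + t n * w\<close> have a weak-* limit
  \<open>\<nu>\<close> along a subsequence. Their entropies converge because the pressure is
  Lipschitz, so upper semicontinuity makes \<open>\<nu>\<close> an equilibrium state for
  \<open>g\<close>, and uniqueness identifies it.\<close>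

lemma eqst_continuous_along_direction:
  assumes g: "g \<in> V" and w: "w \<in> V" and t: "t \<longlonglongrightarrow> 0"
  obtains r where "strict_mono (r :: nat \<Rightarrow> nat)"
    "(\<lambda>n. \<integral>x. w x \<partial>eqst (\<lambda>x. g x + t (r n) * w x)) \<longlonglongrightarrow> (\<integral>x. w x \<partial>eqst g)"
proof -
  define \<nu>s where "\<nu>s n = eqst (\<lambda>x. g x + t n * w x)" for n
  have \<nu>s: "\<nu>s n \<in> M" for n unfolding \<nu>s_def by (intro eqst_in V_add_mult g w)
  from M_compact[of \<nu>s, OF \<nu>s] obtain r \<nu> where r: "strict_mono (r :: nat \<Rightarrow> nat)" "\<nu> \<in> M"
    "weak_star_conv \<Omega> (\<lambda>n. \<nu>s (r n)) \<nu>" by auto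
  have conv: "(\<lambda>n. \<integral>x. h x \<partial>\<nu>s (r n)) \<longlonglongrightarrow> (\<integral>x. h x \<partial>\<nu>)" if "continuous_on \<Omega> h" for h :: "'a \<Rightarrow> real"
    using r(3) that by (simp add: weak_star_conv_def)
  have tr: "(\<lambda>n. t (r n)) \<longlonglongrightarrow> 0" using LIMSEQ_subseq_LIMSEQ[OF t r(1)] by (simp add: o_def)
  obtain B where B: "B \<ge> 0" "\<And>x. x \<in> \<Omega> \<Longrightarrow> \<bar>w x\<bar> \<le> B" using V_bounded[OF w] by blast
  have Pt: "\<bar>P (\<lambda>x. g x + t n * w x) - P g\<bar> \<le> \<bar>t n\<bar> * B" for n
    by (intro P_lipschitz V_add_mult g w) (auto simp: abs_mult intro!: mult_left_mono B(2))
  have "(\<lambda>n. \<bar>t (r n)\<bar> * B) \<longlonglongrightarrow> 0"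
    by (intro tendsto_mult_left_zero tendsto_rabs_zero tr)
  then have Pdiff: "(\<lambda>n. P (\<lambda>x. g x + t (r n) * w x) - P g) \<longlonglongrightarrow> 0"
    by (rule Lim_null_comparison[rotated]) (simp add: Pt)
  \<comment> \<open>Solving the pressure formula for the entropy: every term on the right converges
    along the subsequence, as \<open>H_usc\<close> requires.\<close>
  have H_eq: "H (\<nu>s n) = P (\<lambda>x. g x + t n * w x) - (\<integral>x. f x + g x \<partial>\<nu>s n) - t n * (\<integral>x. w x \<partial>\<nu>s n)" for n
    using P_add_mult[OF g w, of "t n"] unfolding \<nu>s_def by simp
  have "(\<lambda>n. H (\<nu>s (r n))) \<longlonglongrightarrow> P g - (\<integral>x. f x + g x \<partial>\<nu>) - 0 * (\<integral>x. w x \<partial>\<nu>)"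
    unfolding H_eq
    by (intro tendsto_intros conv continuous_intros f_cont V_cont g w tr LIM_zero_cancel[OF Pdiff])
  then have "P g - (\<integral>x. f x + g x \<partial>\<nu>) \<le> H \<nu>"
    using H_usc[OF \<nu>s r(2,3)] by simp
  then have "eqst g = \<nu>" by (intro eqst_eqI g r(2)) simp
  then show thesis
    using that[OF r(1)] conv[OF V_cont[OF w]] by (simp add: \<nu>s_def)
qed

text \<open>Testing the pressure of \<open>g\<close> with the equilibrium state of
  \<open>g + t * w\<close> bounds \<open>P (g + t * w)\<close> above by
  \<open>P g + t * ?I t\<close>. With the hypothesis this gives
  \<open>t * b \<le> t * ?I t + K * t\<^sup>2\<close>; dividing by positive and by negative
  \<open>t\<close> and letting \<open>t\<close> tend to 0 gives both inequalities. The quadratic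
  term makes room for the penalty in the minimisation below.\<close>

lemma eqst_integral_eq_subgradient:
  assumes g: "g \<in> V" and w: "w \<in> V"
    and sub: "\<And>t. P g + t * b \<le> P (\<lambda>x. g x + t * w x) + K * t\<^sup>2"
  shows "(\<integral>x. w x \<partial>eqst g) = b"
proof -
  let ?I = "\<lambda>t. \<integral>x. w x \<partial>eqst (\<lambda>x. g x + t * w x)"
  have key: "t * b \<le> t * ?I t + K * t\<^sup>2" for t
    using sub[of t] P_add_mult[OF g w, of t] le_P[OF g eqst_in[OF V_add_mult[OF g w, of t]]] by linarith
  have ge: "b \<le> ?I t + K * t" if "t > 0" for t
  proof -
    have "t * b \<le> t * (?I t + K * t)" using key[of t] by (simp add: algebra_simps power2_eq_square)
    then show ?thesis using that by simp
  qed
  have le: "?I t + K * t \<le> b" if "t < 0" for t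
  proof -
    have "t * b \<le> t * (?I t + K * t)" using key[of t] by (simp add: algebra_simps power2_eq_square)
    then show ?thesis using that by simp
  qed
  have lim: "(\<lambda>n. 1 / real (Suc n)) \<longlonglongrightarrow> 0" "(\<lambda>n. - (1 / real (Suc n))) \<longlonglongrightarrow> 0"
    using lim_inverse_n' LIMSEQ_Suc tendsto_minus by (force simp del: of_nat_Suc)+
  show ?thesis
  proof (rule antisym)
    obtain r where r: "strict_mono (r :: nat \<Rightarrow> nat)" "(\<lambda>n. ?I (- (1 / real (Suc (r n))))) \<longlonglongrightarrow> (\<integral>x. w x \<partial>eqst g)"
      using eqst_continuous_along_direction[OF g w lim(2)] by blast
    have tr: "(\<lambda>n. - (1 / real (Suc (r n)))) \<longlonglongrightarrow> 0"
      using LIMSEQ_subseq_LIMSEQ[OF lim(2) r(1)] by (simp add: o_def)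
    have "(\<lambda>n. ?I (- (1 / real (Suc (r n)))) + K * (- (1 / real (Suc (r n))))) \<longlonglongrightarrow> (\<integral>x. w x \<partial>eqst g) + K * 0"
      by (intro tendsto_intros r(2) tr)
    moreover have "?I (- (1 / real (Suc (r n)))) + K * (- (1 / real (Suc (r n)))) \<le> b" for n
      by (rule le) simp
    ultimately show "(\<integral>x. w x \<partial>eqst g) \<le> b" using LIMSEQ_le_const2 by fastforce
  next
    obtain r where r: "strict_mono (r :: nat \<Rightarrow> nat)" "(\<lambda>n. ?I (1 / real (Suc (r n)))) \<longlonglongrightarrow> (\<integral>x. w x \<partial>eqst g)"
      using eqst_continuous_along_direction[OF g w lim(1)] by blast
    have tr: "(\<lambda>n. 1 / real (Suc (r n))) \<longlonglongrightarrow> 0"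
      using LIMSEQ_subseq_LIMSEQ[OF lim(1) r(1)] by (simp add: o_def)
    have "(\<lambda>n. ?I (1 / real (Suc (r n))) + K * (1 / real (Suc (r n)))) \<longlonglongrightarrow> (\<integral>x. w x \<partial>eqst g) + K * 0"
      by (intro tendsto_intros r(2) tr)
    moreover have "b \<le> ?I (1 / real (Suc (r n))) + K * (1 / real (Suc (r n)))" for n
      by (rule ge) simp
    ultimately show "b \<le> (\<integral>x. w x \<partial>eqst g)" using LIMSEQ_le_const by fastforce
  qed
qed

section \<open>Penalised minimisation over finitely many coefficients\<close>

text \<open>Coefficients are functions on all of \<open>nat\<close> with the product topology, which
  avoids a type of dimension \<open>k\<close>. The Lipschitz bound for \<open>P\<close> involves
  only the first \<open>k\<close> coordinates, and these are continuous.\<close>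

lemma continuous_P_linear_combination:
  assumes w: "\<And>i. i < k \<Longrightarrow> w i \<in> V"
  shows "continuous_on UNIV (\<lambda>c::nat \<Rightarrow> real. P (\<lambda>x. \<Sum>i<k. c i * w i x))"
proof -
  let ?g = "\<lambda>(c::nat \<Rightarrow> real) x. \<Sum>i<k. c i * w i x"
  have "\<exists>B\<ge>0. \<forall>x\<in>\<Omega>. \<bar>w i x\<bar> \<le> B" if "i < k" for i
    using V_bounded[OF w[OF that]] by metis
  then obtain B where B: "\<And>i x. i < k \<Longrightarrow> x \<in> \<Omega> \<Longrightarrow> \<bar>w i x\<bar> \<le> B i" by metis
  show ?thesis
    unfolding continuous_on_def
  proof
    fix c0 :: "nat \<Rightarrow> real"
    have bound: "\<bar>P (?g c) - P (?g c0)\<bar> \<le> (\<Sum>i<k. \<bar>c i - c0 i\<bar> * B i)" for c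
    proof (rule P_lipschitz[OF V_sum V_sum])
      fix x assume x: "x \<in> \<Omega>"
      have "?g c x - ?g c0 x = (\<Sum>i<k. (c i - c0 i) * w i x)"
        by (simp add: left_diff_distrib sum_subtractf)
      also have "\<bar>\<dots>\<bar> \<le> (\<Sum>i<k. \<bar>c i - c0 i\<bar> * B i)"
        by (rule order_trans[OF sum_abs sum_mono]) (auto simp: abs_mult intro!: mult_left_mono B x)
      finally show "\<bar>?g c x - ?g c0 x\<bar> \<le> (\<Sum>i<k. \<bar>c i - c0 i\<bar> * B i)" .
    qed (use w in auto)
    have "continuous_on UNIV (\<lambda>c::nat \<Rightarrow> real. \<Sum>i<k. \<bar>c i - c0 i\<bar> * B i)"
      by (intro continuous_intros continuous_on_product_coordinates)
    then have "((\<lambda>c. \<Sum>i<k. \<bar>c i - c0 i\<bar> * B i) \<longlongrightarrow> (\<Sum>i<k. \<bar>c0 i - c0 i\<bar> * B i)) (at c0)"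
      unfolding continuous_on_def by blast
    then have "((\<lambda>c. \<Sum>i<k. \<bar>c i - c0 i\<bar> * B i) \<longlongrightarrow> 0) (at c0)" by simp
    then have "((\<lambda>c. P (?g c) - P (?g c0)) \<longlongrightarrow> 0) (at c0)"
      by (rule Lim_null_comparison[rotated]) (use bound in auto)
    then show "((\<lambda>c. P (?g c)) \<longlongrightarrow> P (?g c0)) (at c0)" by (rule LIM_zero_cancel)
  qed
qed

text \<open>The quadratic penalty makes the objective coercive, so that a minimum is attained; the
  price is an error \<open>\<delta> * c i\<close> in the \<open>i\<close>-th integral. The entropy
  bound carries no error, because the penalty enters it with a favourable sign.\<close>

lemma approximating_eqst:
  fixes k :: nat
  assumes w: "\<And>i. i < k \<Longrightarrow> w i \<in> V" and \<mu>: "\<mu> \<in> M" and "\<epsilon> > 0"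
  obtains g where "g \<in> V" "\<And>i. i < k \<Longrightarrow> \<bar>(\<integral>x. w i x \<partial>eqst g) - (\<integral>x. w i x \<partial>\<mu>)\<bar> \<le> \<epsilon>"
    "H \<mu> + (\<integral>x. f x \<partial>\<mu>) - (\<integral>x. f x \<partial>eqst g) \<le> H (eqst g)"
proof -
  let ?g = "\<lambda>(c::nat \<Rightarrow> real) x. \<Sum>i<k. c i * w i x"
  have gV: "?g c \<in> V" for c using V_sum[OF w] .
  define a where "a i = (\<integral>x. w i x \<partial>\<mu>)" for i
  have int_g: "(\<integral>x. f x + ?g c x \<partial>\<nu>) = (\<integral>x. f x \<partial>\<nu>) + (\<Sum>i<k. c i * (\<integral>x. w i x \<partial>\<nu>))" if \<nu>: "\<nu> \<in> M" for c \<nu>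
  proof -
    have "integrable \<nu> f" "\<And>i. i < k \<Longrightarrow> integrable \<nu> (w i)" "integrable \<nu> (?g c)"
      by (intro integrable_M f_cont V_cont gV w \<nu>; assumption)+
    then show ?thesis by (simp add: Bochner_Integration.integral_sum)
  qed
  \<comment> \<open>The deficit of \<open>\<mu>\<close> from being an equilibrium state for
    \<open>f\<close>.\<close>
  define K where "K = P (\<lambda>x. 0) - (\<integral>x. f x \<partial>\<mu>) - H \<mu>"
  have K0: "K \<ge> 0" using le_P[OF V_zero \<mu>] by (simp add: K_def)
  \<comment> \<open>Chosen so that \<open>\<delta> * \<Sum> (c i)\<^sup>2 \<le> 2 * (K + 1)\<close>
    yields \<open>(\<delta> * c i)\<^sup>2 \<le> \<epsilon>\<^sup>2\<close>; the summand 1 keeps the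
    denominator positive when \<open>K = 0\<close>.\<close>
  define \<delta> where "\<delta> = \<epsilon>\<^sup>2 / (2 * (K + 1))"
  have \<delta>: "\<delta> > 0" "\<delta> * (2 * (K + 1)) = \<epsilon>\<^sup>2" using K0 \<open>\<epsilon> > 0\<close> by (auto simp: \<delta>_def)
  define G where "G c = P (?g c) - (\<Sum>i<k. c i * a i) + \<delta> / 2 * (\<Sum>i<k. (c i)\<^sup>2)" for c
  have G0: "G (\<lambda>_. 0) = P (\<lambda>x. 0)" by (simp add: G_def)
  have G_ge: "P (\<lambda>x. 0) - K + \<delta> / 2 * (\<Sum>i<k. (c i)\<^sup>2) \<le> G c" for c
    using le_P[OF gV \<mu>, of c] unfolding int_g[OF \<mu>] G_def K_def a_def by simp
  \<comment> \<open>A coefficient larger than \<open>R\<close> in absolute value has penalty at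
    least \<open>K + 1\<close>, so there \<open>G\<close> is at least
    \<open>P (\<lambda>x. 0) + 1\<close>, above its value at 0.\<close>
  define R where "R = sqrt (2 * (K + 1) / \<delta>)"
  have R: "R \<ge> 0" "\<delta> / 2 * R\<^sup>2 = K + 1" using K0 \<delta>(1) by (auto simp: R_def)
  \<comment> \<open>The box has infinitely many factors and is compact by Tychonoff's theorem;
    \<open>G\<close> depends on the first \<open>k\<close> coordinates alone.\<close>
  let ?box = "PiE UNIV (\<lambda>_::nat. {-R..R})"
  have "compact ?box"
    using compactin_PiE[of "\<lambda>_. euclidean" UNIV "\<lambda>_::nat. {-R..R}"]
    by (simp add: euclidean_product_topology)
  moreover have "(\<lambda>_. 0) \<in> ?box" using R(1) by auto
  moreover have "continuous_on ?box G"
    unfolding G_def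
    by (rule continuous_on_subset[where s=UNIV])
      (auto intro!: continuous_intros continuous_P_linear_combination w continuous_on_product_coordinates)
  ultimately obtain c where c: "c \<in> ?box" "\<And>d. d \<in> ?box \<Longrightarrow> G c \<le> G d"
    using continuous_attains_inf[of ?box G] by blast
  have G_cong: "G d = G d'" if "\<And>i. i < k \<Longrightarrow> d i = d' i" for d d'
    using that by (simp add: G_def)
  have min: "G c \<le> G d" for d
  proof (cases "\<forall>i<k. \<bar>d i\<bar> \<le> R")
    case True
    \<comment> \<open>Coordinates from \<open>k\<close> on are reset to 0: this puts the point into
      the box and leaves \<open>G\<close> unchanged.\<close>
    then have "(\<lambda>i. if i < k then d i else 0) \<in> ?box" using R(1) by (auto simp: abs_le_iff)
    from c(2)[OF this] show ?thesis using G_cong[of "\<lambda>i. if i < k then d i else 0" d] by simp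
  next
    case False
    then obtain i where i: "i < k" "R < \<bar>d i\<bar>" by auto
    have "R\<^sup>2 \<le> (d i)\<^sup>2" using power_mono[of R "\<bar>d i\<bar>" 2] i R(1) by simp
    also have "\<dots> \<le> (\<Sum>i<k. (d i)\<^sup>2)" using i(1) by (intro member_le_sum) auto
    finally have "\<delta> / 2 * R\<^sup>2 \<le> \<delta> / 2 * (\<Sum>i<k. (d i)\<^sup>2)" using \<delta>(1) by (intro mult_left_mono) auto
    then have "P (\<lambda>x. 0) \<le> G d" using G_ge[of d] R(2) by linarith
    then show ?thesis using c(2)[OF \<open>(\<lambda>_. 0) \<in> ?box\<close>] G0 by simp
  qed
  \<comment> \<open>First-order condition. Moving the \<open>i\<close>-th coordinate of the
    minimiser by \<open>t\<close> changes the penalty by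
    \<open>\<delta> * t * c i + \<delta> / 2 * t\<^sup>2\<close>, so minimality is the subgradient
    hypothesis with \<open>b = a i - \<delta> * c i\<close> and
    \<open>K = \<delta>/2\<close>.\<close>
  have fo: "(\<integral>x. w i x \<partial>eqst (?g c)) = a i - \<delta> * c i" if i: "i < k" for i
  proof (rule eqst_integral_eq_subgradient[OF gV w[OF i], where K="\<delta>/2"])
    fix t
    have upd: "(\<Sum>j<k. F j ((c(i := c i + t)) j)) = (\<Sum>j<k. F j (c j)) - F i (c i) + F i (c i + t)"
      for F :: "nat \<Rightarrow> real \<Rightarrow> real"
    proof -
      have "(\<Sum>j\<in>{..<k} - {i}. F j ((c(i := c i + t)) j)) = (\<Sum>j\<in>{..<k} - {i}. F j (c j))"
        by (rule sum.cong) auto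
      moreover have "(\<Sum>j<k. h j) = h i + (\<Sum>j\<in>{..<k} - {i}. h j)" for h :: "nat \<Rightarrow> real"
        using i by (intro sum.remove) auto
      from this[of "\<lambda>j. F j ((c(i := c i + t)) j)"] this[of "\<lambda>j. F j (c j)"] calculation
      show ?thesis by simp
    qed
    have g: "?g (c(i := c i + t)) = (\<lambda>x. ?g c x + t * w i x)"
    proof
      fix x show "?g (c(i := c i + t)) x = ?g c x + t * w i x"
        using upd[of "\<lambda>j y. y * w j x"] by (simp add: algebra_simps)
    qed
    have "(\<Sum>j<k. (c(i := c i + t)) j * a j) = (\<Sum>j<k. c j * a j) + t * a i"
      using upd[of "\<lambda>j y. y * a j"] by (simp add: algebra_simps)
    moreover have "(\<Sum>j<k. ((c(i := c i + t)) j)\<^sup>2) = (\<Sum>j<k. (c j)\<^sup>2) + (2 * t * c i + t\<^sup>2)"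
      using upd[of "\<lambda>j y. y\<^sup>2"] by (simp add: power2_sum algebra_simps)
    ultimately have "G (c(i := c i + t)) = P (\<lambda>x. ?g c x + t * w i x) - ((\<Sum>j<k. c j * a j) + t * a i)
        + \<delta> / 2 * ((\<Sum>j<k. (c j)\<^sup>2) + (2 * t * c i + t\<^sup>2))"
      unfolding G_def g by simp
    then show "P (?g c) + t * (a i - \<delta> * c i) \<le> P (\<lambda>x. ?g c x + t * w i x) + \<delta> / 2 * t\<^sup>2"
      using min[of "c(i := c i + t)"] unfolding G_def[of c] by (simp add: algebra_simps)
  qed
  show thesis
  proof
    show "?g c \<in> V" by (rule gV)
    \<comment> \<open>At the minimiser \<open>G c \<le> G 0 = P 0\<close>, and the lower bound for
      \<open>G\<close> then leaves at most \<open>K\<close> for the penalty.\<close>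
    have "\<delta> / 2 * (\<Sum>i<k. (c i)\<^sup>2) \<le> K" using G_ge[of c] min[of "\<lambda>_. 0"] G0 by linarith
    then have "\<delta> * (\<Sum>i<k. (c i)\<^sup>2) \<le> 2 * (K + 1)" using K0 by simp
    then have sumle: "\<delta> * (\<delta> * (\<Sum>i<k. (c i)\<^sup>2)) \<le> \<epsilon>\<^sup>2"
      unfolding \<delta>(2)[symmetric] using \<delta>(1) by (intro mult_left_mono) auto
    show "\<bar>(\<integral>x. w i x \<partial>eqst (?g c)) - (\<integral>x. w i x \<partial>\<mu>)\<bar> \<le> \<epsilon>" if i: "i < k" for i
    proof -
      have "(c i)\<^sup>2 \<le> (\<Sum>i<k. (c i)\<^sup>2)" using i by (intro member_le_sum) auto
      then have "\<delta> * (\<delta> * (c i)\<^sup>2) \<le> \<delta> * (\<delta> * (\<Sum>i<k. (c i)\<^sup>2))" using \<delta>(1) by (intro mult_left_mono) auto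
      then have "(\<delta> * c i)\<^sup>2 \<le> \<epsilon>\<^sup>2" using sumle by (simp add: power2_eq_square algebra_simps)
      then have "\<bar>\<delta> * c i\<bar> \<le> \<epsilon>" using \<open>\<epsilon> > 0\<close> by (simp add: abs_le_square_iff[symmetric])
      then show ?thesis using fo[OF i] by (simp add: a_def)
    qed
    have "P (?g c) = (\<integral>x. f x \<partial>eqst (?g c)) + (\<Sum>i<k. c i * (a i - \<delta> * c i)) + H (eqst (?g c))"
      using fo unfolding P_def int_g[OF eqst_in[OF gV]] by simp
    moreover have "(\<Sum>i<k. c i * (a i - \<delta> * c i)) = (\<Sum>i<k. c i * a i) - \<delta> * (\<Sum>i<k. (c i)\<^sup>2)"
      by (simp add: right_diff_distrib sum_subtractf sum_distrib_left power2_eq_square algebra_simps)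
    moreover have "(\<integral>x. f x \<partial>\<mu>) + (\<Sum>i<k. c i * a i) + H \<mu> \<le> P (?g c)"
      using le_P[OF gV \<mu>, of c] unfolding int_g[OF \<mu>] a_def .
    moreover have "0 \<le> \<delta> * (\<Sum>i<k. (c i)\<^sup>2)" using \<delta>(1) by (simp add: sum_nonneg)
    ultimately show "H \<mu> + (\<integral>x. f x \<partial>\<mu>) - (\<integral>x. f x \<partial>eqst (?g c)) \<le> H (eqst (?g c))" by linarith
  qed
qed

end

section \<open>Transfer from extended-real entropy and proof of the theorem\<close>

text \<open>With finite entropies, attaining the extended-real supremum amounts to a family of real
  inequalities, the form in which the locale states uniqueness.\<close>

lemma equilibrium_state_iff:
  assumes fin: "\<And>\<nu>. \<nu> \<in> inv_measures \<Omega> l T \<Longrightarrow> KS_entropy \<Omega> l T \<nu> = ereal (H \<nu>)"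
  shows "equilibrium_state \<Omega> l T g \<nu> \<longleftrightarrow> \<nu> \<in> inv_measures \<Omega> l T \<and>
    (\<forall>\<nu>'\<in>inv_measures \<Omega> l T. (\<integral>x. g x \<partial>\<nu>') + H \<nu>' \<le> (\<integral>x. g x \<partial>\<nu>) + H \<nu>)"
proof -
  have P: "pressure \<Omega> l T g = (SUP \<nu>\<in>inv_measures \<Omega> l T. ereal ((\<integral>x. g x \<partial>\<nu>) + H \<nu>))"
    unfolding pressure_def by (rule SUP_cong) (simp_all add: fin)
  have "ereal ((\<integral>x. g x \<partial>\<nu>) + H \<nu>) = pressure \<Omega> l T g \<longleftrightarrow>
      (\<forall>\<nu>'\<in>inv_measures \<Omega> l T. (\<integral>x. g x \<partial>\<nu>') + H \<nu>' \<le> (\<integral>x. g x \<partial>\<nu>) + H \<nu>)"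
    if "\<nu> \<in> inv_measures \<Omega> l T"
  proof
    assume eq: "ereal ((\<integral>x. g x \<partial>\<nu>) + H \<nu>) = pressure \<Omega> l T g"
    show "\<forall>\<nu>'\<in>inv_measures \<Omega> l T. (\<integral>x. g x \<partial>\<nu>') + H \<nu>' \<le> (\<integral>x. g x \<partial>\<nu>) + H \<nu>"
    proof
      fix \<nu>' assume "\<nu>' \<in> inv_measures \<Omega> l T"
      then have "ereal ((\<integral>x. g x \<partial>\<nu>') + H \<nu>') \<le> ereal ((\<integral>x. g x \<partial>\<nu>) + H \<nu>)"
        unfolding eq P by (rule SUP_upper)
      then show "(\<integral>x. g x \<partial>\<nu>') + H \<nu>' \<le> (\<integral>x. g x \<partial>\<nu>) + H \<nu>" by simp
    qed
  next
    assume *: "\<forall>\<nu>'\<in>inv_measures \<Omega> l T. (\<integral>x. g x \<partial>\<nu>') + H \<nu>' \<le> (\<integral>x. g x \<partial>\<nu>) + H \<nu>"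
    show "ereal ((\<integral>x. g x \<partial>\<nu>) + H \<nu>) = pressure \<Omega> l T g"
      unfolding P
    proof (rule antisym)
      show "ereal ((\<integral>x. g x \<partial>\<nu>) + H \<nu>) \<le> (SUP \<nu>\<in>inv_measures \<Omega> l T. ereal ((\<integral>x. g x \<partial>\<nu>) + H \<nu>))"
        using that by (rule SUP_upper)
      show "(SUP \<nu>\<in>inv_measures \<Omega> l T. ereal ((\<integral>x. g x \<partial>\<nu>) + H \<nu>)) \<le> ereal ((\<integral>x. g x \<partial>\<nu>) + H \<nu>)"
        using * by (intro SUP_least) simp
    qed
  qed
  then show ?thesis unfolding equilibrium_state_def by (auto simp: fin)
qed

theorem theorem1:
  fixes \<Omega> :: "'a::metric_space set" and l :: nat and T :: "nat \<Rightarrow> 'a \<Rightarrow> 'a"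
    and f :: "'a \<Rightarrow> real" and V :: "('a \<Rightarrow> real) set" and \<mu> :: "'a measure"
  assumes "compact \<Omega>" and "\<Omega> \<noteq> {}" and "l \<ge> 1"
    and "cont_action \<Omega> l T"
    and "\<forall>\<nu>\<in>inv_measures \<Omega> l T. KS_entropy \<Omega> l T \<nu> < \<infinity>"
    and "entropy_usc \<Omega> l T"
    and "continuous_on \<Omega> f"
    and "C_subspace \<Omega> V" and "uniformly_dense \<Omega> V"
    and "\<forall>g\<in>V. \<exists>!\<nu>. equilibrium_state \<Omega> l T (\<lambda>x. f x + g x) \<nu>"
    and "\<mu> \<in> inv_measures \<Omega> l T"
  shows "\<exists>\<mu>s gs. (\<forall>n. \<mu>s n \<in> inv_measures \<Omega> l T \<and> gs n \<in> V \<and>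
                      equilibrium_state \<Omega> l T (\<lambda>x. f x + gs n x) (\<mu>s n)) \<and>
                 weak_star_conv \<Omega> \<mu>s \<mu> \<and>
                 (\<lambda>n. KS_entropy \<Omega> l T (\<mu>s n)) \<longlonglongrightarrow> KS_entropy \<Omega> l T \<mu>"
proof -
  let ?M = "inv_measures \<Omega> l T" and ?h = "KS_entropy \<Omega> l T"
  define H where "H \<nu> = real_of_ereal (?h \<nu>)" for \<nu>
  have sub: "?M \<subseteq> prob_measures \<Omega>" by (auto simp: inv_measures_def)
  have h_eq: "?h \<nu> = ereal (H \<nu>)" if "\<nu> \<in> ?M" for \<nu>
    using KS_entropy_nonneg[OF assms(4), of \<nu>] assms(5) sub that unfolding H_def
    by (cases "?h \<nu>") auto
  have eq_iff: "equilibrium_state \<Omega> l T g \<nu> \<longleftrightarrow>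
      \<nu> \<in> ?M \<and> (\<forall>\<nu>'\<in>?M. (\<integral>x. g x \<partial>\<nu>') + H \<nu>' \<le> (\<integral>x. g x \<partial>\<nu>) + H \<nu>)" for g \<nu>
    by (rule equilibrium_state_iff) (rule h_eq)
  have usc: "limsup (\<lambda>n. ?h (\<mu>s n)) \<le> ?h \<nu>"
    if "\<And>n. \<mu>s n \<in> ?M" "\<nu> \<in> ?M" "weak_star_conv \<Omega> \<mu>s \<nu>" for \<mu>s \<nu>
    using assms(6) that unfolding entropy_usc_def by blast
  interpret unique_equilibria \<Omega> ?M H f V
  proof
    show "\<exists>r \<nu>. strict_mono (r :: nat \<Rightarrow> nat) \<and> \<nu> \<in> ?M \<and> weak_star_conv \<Omega> (\<lambda>n. \<mu>s (r n)) \<nu>"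
      if \<mu>s: "\<And>n. \<mu>s n \<in> ?M" for \<mu>s
    proof -
      have "\<mu>s n \<in> prob_measures \<Omega>" for n using \<mu>s sub by blast
      from prob_measures_seq_compact[of \<Omega> \<mu>s, OF assms(1) this] obtain r \<nu> where
        r: "strict_mono (r :: nat \<Rightarrow> nat)" "\<nu> \<in> prob_measures \<Omega>" "weak_star_conv \<Omega> (\<lambda>n. \<mu>s (r n)) \<nu>" .
      then show ?thesis using inv_measures_closed[OF assms(1,4) \<mu>s r(2,3)] by blast
    qed
    show "L \<le> H \<nu>" if "\<And>n. \<mu>s n \<in> ?M" "\<nu> \<in> ?M" "weak_star_conv \<Omega> \<mu>s \<nu>" "(\<lambda>n. H (\<mu>s n)) \<longlonglongrightarrow> L"
      for \<mu>s \<nu> L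
    proof -
      have "(\<lambda>n. ereal (H (\<mu>s n))) \<longlonglongrightarrow> ereal L" using that(4) by simp
      then have "limsup (\<lambda>n. ereal (H (\<mu>s n))) = ereal L" by (intro lim_imp_Limsup) auto
      then show ?thesis using usc[OF that(1-3)] by (simp add: h_eq that)
    qed
    show "\<exists>!\<nu>. \<nu> \<in> ?M \<and> (\<forall>\<nu>'\<in>?M. (\<integral>x. f x + g x \<partial>\<nu>') + H \<nu>' \<le> (\<integral>x. f x + g x \<partial>\<nu>) + H \<nu>)"
      if "g \<in> V" for g
      using bspec[OF assms(10) that] unfolding eq_iff .
  qed (fact assms sub)+
  obtain w :: "nat \<Rightarrow> 'a \<Rightarrow> real" where w: "\<And>i. w i \<in> V"
    "\<And>\<mu>s \<mu>. (\<And>n. \<mu>s n \<in> prob_measures \<Omega>) \<Longrightarrow> \<mu> \<in> prob_measures \<Omega> \<Longrightarrow>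
      (\<And>i. (\<lambda>n. \<integral>x. w i x \<partial>\<mu>s n) \<longlonglongrightarrow> (\<integral>x. w i x \<partial>\<mu>)) \<Longrightarrow> weak_star_conv \<Omega> \<mu>s \<mu>"
    by (rule weak_star_test_sequence[OF assms(1,2,9)]) (auto intro: V_cont that)
  \<comment> \<open>The index \<open>n\<close> governs both the number of test functions and the
    precision; a fixed \<open>w i\<close> is controlled as soon as \<open>n > i\<close>.\<close>
  have "\<exists>g. g \<in> V \<and> (\<forall>i<n. \<bar>(\<integral>x. w i x \<partial>eqst g) - (\<integral>x. w i x \<partial>\<mu>)\<bar> \<le> 1 / real (Suc n)) \<and>
      H \<mu> + (\<integral>x. f x \<partial>\<mu>) - (\<integral>x. f x \<partial>eqst g) \<le> H (eqst g)" for n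
    by (rule approximating_eqst[of n w, OF w(1) assms(11), of "1 / real (Suc n)"]) auto
  then obtain gs where gs: "\<And>n. gs n \<in> V"
    "\<And>n i. i < n \<Longrightarrow> \<bar>(\<integral>x. w i x \<partial>eqst (gs n)) - (\<integral>x. w i x \<partial>\<mu>)\<bar> \<le> 1 / real (Suc n)"
    "\<And>n. H \<mu> + (\<integral>x. f x \<partial>\<mu>) - (\<integral>x. f x \<partial>eqst (gs n)) \<le> H (eqst (gs n))"
    by metis
  define \<mu>s where "\<mu>s n = eqst (gs n)" for n
  have \<mu>s: "\<mu>s n \<in> ?M" for n unfolding \<mu>s_def by (rule eqst_in[OF gs(1)])
  have "equilibrium_state \<Omega> l T (\<lambda>x. f x + gs n x) (\<mu>s n)" for n
    unfolding eq_iff \<mu>s_def using eqst_max[OF gs(1), of n] unfolding P_def .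
  moreover have wk: "weak_star_conv \<Omega> \<mu>s \<mu>"
  proof (rule w(2))
    fix i
    have "(\<lambda>n. (\<integral>x. w i x \<partial>\<mu>s n) - (\<integral>x. w i x \<partial>\<mu>)) \<longlonglongrightarrow> 0"
    proof (rule Lim_null_comparison)
      show "\<forall>\<^sub>F n in sequentially. norm ((\<integral>x. w i x \<partial>\<mu>s n) - (\<integral>x. w i x \<partial>\<mu>)) \<le> 1 / real (Suc n)"
        using eventually_gt_at_top[of i] by eventually_elim (simp add: \<mu>s_def gs(2) del: of_nat_Suc)
      show "(\<lambda>n. 1 / real (Suc n)) \<longlonglongrightarrow> 0" using LIMSEQ_Suc[OF lim_inverse_n'] .
    qed
    then show "(\<lambda>n. \<integral>x. w i x \<partial>\<mu>s n) \<longlonglongrightarrow> (\<integral>x. w i x \<partial>\<mu>)" by (rule LIM_zero_cancel)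
  qed (use \<mu>s sub assms(11) in auto)
  moreover have "(\<lambda>n. ?h (\<mu>s n)) \<longlonglongrightarrow> ?h \<mu>"
  proof -
    \<comment> \<open>As \<open>f\<close> is itself a continuous test function, the lower bounds for
      the entropies of \<open>\<mu>s n\<close> tend to the entropy of \<open>\<mu>\<close>; upper
      semicontinuity gives the matching upper bound.\<close>
    have "(\<lambda>n. \<integral>x. f x \<partial>\<mu>s n) \<longlonglongrightarrow> (\<integral>x. f x \<partial>\<mu>)"
      using wk assms(7) by (simp add: weak_star_conv_def)
    then have "(\<lambda>n. H \<mu> + (\<integral>x. f x \<partial>\<mu>) - (\<integral>x. f x \<partial>\<mu>s n)) \<longlonglongrightarrow> H \<mu> + (\<integral>x. f x \<partial>\<mu>) - (\<integral>x. f x \<partial>\<mu>)"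
      by (intro tendsto_intros)
    then have "(\<lambda>n. ereal (H \<mu> + (\<integral>x. f x \<partial>\<mu>) - (\<integral>x. f x \<partial>\<mu>s n))) \<longlonglongrightarrow> ?h \<mu>"
      by (simp add: h_eq assms(11))
    then have "?h \<mu> = liminf (\<lambda>n. ereal (H \<mu> + (\<integral>x. f x \<partial>\<mu>) - (\<integral>x. f x \<partial>\<mu>s n)))"
      by (intro lim_imp_Liminf[symmetric]) auto
    also have "\<dots> \<le> liminf (\<lambda>n. ?h (\<mu>s n))"
      using gs(3) by (intro Liminf_mono always_eventually) (simp add: h_eq[OF \<mu>s] \<mu>s_def[symmetric])
    finally have "?h \<mu> \<le> liminf (\<lambda>n. ?h (\<mu>s n))" .
    moreover have "liminf (\<lambda>n. ?h (\<mu>s n)) \<le> limsup (\<lambda>n. ?h (\<mu>s n))"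
      by (rule Liminf_le_Limsup) simp
    ultimately show ?thesis
      using usc[OF \<mu>s assms(11) wk] by (intro Liminf_eq_Limsup) auto
  qed
  ultimately show ?thesis using \<mu>s gs(1) by blast
qed

end
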